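(* Let $\mu,\nu>0$ with $\mu+\nu=1$. For each integer $N\ge1$ let $C_N$ be an integer with $1\le C_N\le N$, and let $(X_N(t))_{t\ge0}$ be the Engset process with $N$ sources, capacity $C_N$ and parameters $\nu,\mu$, started at $X_N(0)=0$. Let $T_{C_N}^{X_N}=\inf\{s\ge0:X_N(s)=C_N\}$. If $C_N=\eta N+O(1)$ as $N\to+\infty$ for some $\eta\in(0,1]$ with $\eta<\nu$, then the sequence of random variables $$\sqrt{N}\left[T_{C_N}^{X_N}-\log\left(\frac{\nu}{\nu-\eta}\right)\right]$$ converges in distribution, as $N\to+\infty$, to a centered normal random variable with variance $$\frac{\eta(1-\eta)}{(\nu-\eta)^2}.$$
   Context: The Engset process $(X_N(t))_{t\ge0}$ with $N$ sources, capacity $C_N$ ($1\le C_N\le N$) and parameters $\nu,\mu>0$ is the continuous-time (right-continuous) birth and death Markov process on $\{0,1,\ldots,C_N\}$ with transition rates $q(x,x-1)=\mu x$ for $0\le x\le C_N$ and $q(x,x+1)=\nu(N-x)$ for $0\le x<C_N$ (no upward jump from $C_N$). The time scale is normalized so that $\mu+\nu=1$. *)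

theory Defs
  imports "HOL-Probability.Probability"
begin

definition transition_function ::
  "nat set \<Rightarrow> (real \<Rightarrow> nat \<Rightarrow> nat \<Rightarrow> real) \<Rightarrow> bool" where
  "transition_function S P \<longleftrightarrow>
     (\<forall>t\<ge>0. \<forall>x\<in>S. (\<forall>y\<in>S. 0 \<le> P t x y) \<and> (\<Sum>y\<in>S. P t x y) = 1) \<and>
     (\<forall>x\<in>S. \<forall>y\<in>S. P 0 x y = (if x = y then 1 else 0)) \<and>
     (\<forall>s\<ge>0. \<forall>t\<ge>0. \<forall>x\<in>S. \<forall>y\<in>S. P (s + t) x y = (\<Sum>z\<in>S. P s x z * P t z y))"

(* Only off-diagonal rates are prescribed: on a finite state space the diagonal ones
   follow because the rows of P sum to 1. *)
definition has_transition_rates ::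
  "nat set \<Rightarrow> (real \<Rightarrow> nat \<Rightarrow> nat \<Rightarrow> real) \<Rightarrow> (nat \<Rightarrow> nat \<Rightarrow> real) \<Rightarrow> bool" where
  "has_transition_rates S P q \<longleftrightarrow>
     (\<forall>x\<in>S. \<forall>y\<in>S. x \<noteq> y \<longrightarrow> ((\<lambda>h. P h x y / h) \<longlongrightarrow> q x y) (at_right 0))"

(* The history is an arbitrary finite list of past observations t 0 < ... < t n, the last one
   being the present. *)
definition markov_with_transition_function ::
  "nat set \<Rightarrow> 'a measure \<Rightarrow> (real \<Rightarrow> 'a \<Rightarrow> nat) \<Rightarrow> (real \<Rightarrow> nat \<Rightarrow> nat \<Rightarrow> real) \<Rightarrow> bool" where
  "markov_with_transition_function S M X P \<longleftrightarrow>
     (\<forall>(n::nat) (t :: nat \<Rightarrow> real) (x :: nat \<Rightarrow> nat). \<forall>h\<ge>0. \<forall>y\<in>S.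
        0 \<le> t 0 \<longrightarrow> (\<forall>i<n. t i < t (Suc i)) \<longrightarrow> (\<forall>i\<le>n. x i \<in> S) \<longrightarrow>
        \<P>(\<omega> in M. \<forall>i\<le>n. X (t i) \<omega> = x i) > 0 \<longrightarrow>
        \<P>(\<omega> in M. X (t n + h) \<omega> = y \<bar> \<forall>i\<le>n. X (t i) \<omega> = x i) = P h (x n) y)"

(* Right-continuity is with respect to the discrete topology on nat. *)
locale finite_markov_jump_process = prob_space M
  for M :: "'a measure" and S :: "nat set" and q :: "nat \<Rightarrow> nat \<Rightarrow> real"
    and X :: "real \<Rightarrow> 'a \<Rightarrow> nat" +
  assumes finite_states: "finite S"
    and measurable_X: "\<And>t. 0 \<le> t \<Longrightarrow> X t \<in> measurable M (count_space S)"
    and right_continuous: "\<And>\<omega> t. \<omega> \<in> space M \<Longrightarrow> 0 \<le> t \<Longrightarrow> continuous (at_right t) (\<lambda>s. X s \<omega>)"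
    and markov: "\<exists>P. transition_function S P \<and> has_transition_rates S P q \<and>
                     markov_with_transition_function S M X P"

definition engset_rate :: "nat \<Rightarrow> nat \<Rightarrow> real \<Rightarrow> real \<Rightarrow> nat \<Rightarrow> nat \<Rightarrow> real" where
  "engset_rate N C \<nu> \<mu> x y =
     (if x = Suc y then \<mu> * real x
      else if y = Suc x \<and> x < C then \<nu> * (real N - real x)
      else 0)"

definition engset_process ::
  "'a measure \<Rightarrow> nat \<Rightarrow> nat \<Rightarrow> real \<Rightarrow> real \<Rightarrow> (real \<Rightarrow> 'a \<Rightarrow> nat) \<Rightarrow> bool" where
  "engset_process M N C \<nu> \<mu> X \<longleftrightarrow>
     finite_markov_jump_process M {0..C} (engset_rate N C \<nu> \<mu>) X"

(* Equal to \<infinity> if the state c is never reached. *)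
definition hitting_time :: "(real \<Rightarrow> 'a \<Rightarrow> nat) \<Rightarrow> nat \<Rightarrow> 'a \<Rightarrow> ereal" where
  "hitting_time X c \<omega> = (INF s\<in>{s. 0 \<le> s \<and> X s \<omega> = c}. ereal s)"

(* Convergence in distribution of real random variables Y n, each on its own space M n. *)
definition converges_in_distribution ::
  "(nat \<Rightarrow> 'a measure) \<Rightarrow> (nat \<Rightarrow> 'a \<Rightarrow> real) \<Rightarrow> real measure \<Rightarrow> bool" where
  "converges_in_distribution M Y L \<longleftrightarrow> weak_conv_m (\<lambda>n. distr (M n) borel (Y n)) L"

(* normal_density takes the standard deviation as its second argument. *)
definition centered_normal :: "real \<Rightarrow> real measure" where
  "centered_normal v = density lborel (normal_density 0 (sqrt v))"

end

theory Submission
  imports Defs "HOL-Real_Asymp.Real_Asymp"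
begin

text \<open>Compare the Engset process with the process of \<open>N\<close> independent on-off sources without capacity
  constraint. Started at \<open>0\<close>, the latter is binomial at time \<open>t\<close> with success probability
  \<open>p t = \<nu> * (1 - exp (- t))\<close>. Both processes have the same dynamics up to the hitting time \<open>T\<close> of \<open>C\<close>,
  and since \<open>C\<close> is below the equilibrium \<open>\<nu> * N\<close>, from there the unconstrained process is, at any
  given time at least \<open>e / sqrt N\<close> later, at or above \<open>C\<close> with probability close to \<open>1\<close>. Hence \<open>P (T \<le> t)\<close> is
  squeezed between the binomial tail at \<open>t\<close> and, up to a factor tending to \<open>1\<close>, the one at a slightly
  later time. At \<open>t = ln (\<nu> / (\<nu> - \<eta>)) + y / sqrt N\<close> the binomial tail converges by the central limit
  theorem; the variance is \<open>\<eta> * (1 - \<eta>)\<close> divided by the square of \<open>p' = \<nu> - \<eta>\<close>.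

  No coupling is needed: the tail probability solves the backward equation of the unconstrained process,
  which gives the comparison with the hitting probabilities along a time grid up to an error
  that vanishes with the mesh.\<close>

section \<open>Sums of independent Bernoulli variables and the unconstrained process\<close>

text \<open>For \<open>p\<close> in the unit interval, \<open>(bern_avg p ^^ n) f k\<close> is the
  expectation of \<open>f (k + B)\<close> with \<open>B\<close> binomial with parameters
  \<open>n\<close> and \<open>p\<close>. Using the operator instead of a measure turns statements
  about independent trials into inductions on \<open>n\<close>; values in a vector space also admit
  complex exponentials.\<close>

definition bern_avg :: "real \<Rightarrow> (nat \<Rightarrow> 'b::real_vector) \<Rightarrow> nat \<Rightarrow> 'b" where
  "bern_avg p f k = (1 - p) *\<^sub>R f k + p *\<^sub>R f (Suc k)"

definition forward_diff :: "(nat \<Rightarrow> real) \<Rightarrow> nat \<Rightarrow> real" where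
  "forward_diff f k = f (Suc k) - f k"

lemma bern_avg_commute:
  fixes f :: "nat \<Rightarrow> real"
  shows "bern_avg p (bern_avg q f) = bern_avg q (bern_avg p f)"
  by (rule ext) (simp add: bern_avg_def algebra_simps)

lemma bern_avg_funpow_commute:
  fixes f :: "nat \<Rightarrow> real"
  shows "bern_avg p ((bern_avg q ^^ n) f) = (bern_avg q ^^ n) (bern_avg p f)"
  by (induction n) (simp, simp, metis bern_avg_commute)

lemma bern_avg_forward_diff:
  "bern_avg p (forward_diff f) = forward_diff (bern_avg p f)"
  by (rule ext) (simp add: bern_avg_def forward_diff_def algebra_simps)

lemma bern_avg_funpow_forward_diff:
  "(bern_avg p ^^ n) (forward_diff f) = forward_diff ((bern_avg p ^^ n) f)"
  by (induction n) (simp_all add: bern_avg_forward_diff)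

lemma bern_avg_param_diff:
  "bern_avg p f k - bern_avg q f k = (p - q) * forward_diff f k"
  by (simp add: bern_avg_def forward_diff_def algebra_simps)

lemma bern_avg_funpow_mono:
  fixes f g :: "nat \<Rightarrow> real"
  assumes "0 \<le> p" "p \<le> 1" "\<And>k. f k \<le> g k"
  shows "(bern_avg p ^^ n) f k \<le> (bern_avg p ^^ n) g k"
proof (induction n arbitrary: k)
  case (Suc n)
  show ?case
    using Suc[of k] Suc[of "Suc k"] assms(1,2)
    by (simp add: bern_avg_def add_mono mult_left_mono)
qed (simp add: assms)

lemma bern_avg_funpow_const: "(bern_avg p ^^ n) (\<lambda>_. c) k = (c :: real)"
proof (induction n arbitrary: k)
  case (Suc n)
  then show ?case
    unfolding funpow.simps comp_def bern_avg_def[of p _ k] by (simp add: algebra_simps)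
qed simp

lemma bern_avg_funpow_diff:
  fixes f g :: "nat \<Rightarrow> real"
  shows "(bern_avg p ^^ n) (\<lambda>k. f k - g k) k = (bern_avg p ^^ n) f k - (bern_avg p ^^ n) g k"
proof (induction n arbitrary: k)
  case (Suc n)
  show ?case
    unfolding funpow.simps comp_def bern_avg_def[of p _ k] Suc by (simp add: algebra_simps)
qed simp

lemma bern_avg_funpow_cmult:
  fixes f :: "nat \<Rightarrow> real"
  shows "(bern_avg p ^^ n) (\<lambda>k. c * f k) k = c * (bern_avg p ^^ n) f k"
proof (induction n arbitrary: k)
  case (Suc n)
  show ?case
    unfolding funpow.simps comp_def bern_avg_def[of p _ k] Suc by (simp add: algebra_simps)
qed simp

text \<open>Product rule for \<open>n\<close> commuting factors \<open>bern_avg (p s)\<close>: each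
  is affine in \<open>p s\<close>, its derivative is \<open>p'\<close> times a forward difference,
  and this commutes with the remaining factors, so the \<open>n\<close> terms coincide.
  \<open>F\<close> may depend on \<open>s\<close>, so that operators with two different parameters
  can be nested.\<close>

lemma bern_avg_funpow_has_derivative:
  fixes p :: "real \<Rightarrow> real" and F :: "real \<Rightarrow> nat \<Rightarrow> real"
  assumes p: "(p has_real_derivative p') (at s)"
    and F: "\<And>k. ((\<lambda>s. F s k) has_real_derivative F' k) (at s)"
  shows "((\<lambda>s. (bern_avg (p s) ^^ n) (F s) k) has_real_derivative
           real n * p' * forward_diff ((bern_avg (p s) ^^ (n - 1)) (F s)) k
             + (bern_avg (p s) ^^ n) F' k) (at s)"
proof (induction n arbitrary: k)
  case 0
  show ?case by (simp add: F)
next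
  case (Suc n)
  have *: "forward_diff ((bern_avg (p s) ^^ n) (F s)) k =
      bern_avg (p s) (forward_diff ((bern_avg (p s) ^^ (n - 1)) (F s))) k" if "n > 0"
  proof -
    have "n = Suc (n - 1)" using that by simp
    then have "(bern_avg (p s) ^^ n) (F s) = bern_avg (p s) ((bern_avg (p s) ^^ (n - 1)) (F s))"
      by (metis comp_apply funpow.simps(2))
    thus ?thesis by (simp add: bern_avg_forward_diff)
  qed
  \<comment> \<open>At \<open>n = 0\<close>, where \<open>n - 1\<close> is truncated, the factor
    \<open>real n\<close> makes both sides vanish.\<close>
  have **: "real n * forward_diff ((bern_avg (p s) ^^ n) (F s)) k =
     real n * bern_avg (p s) (forward_diff ((bern_avg (p s) ^^ (n - 1)) (F s))) k"
    using * by (cases "n = 0") auto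
  define E where "E s k = (bern_avg (p s) ^^ n) (F s) k" for s k
  have E_eq: "E s = (bern_avg (p s) ^^ n) (F s)" for s by (auto simp: E_def)
  define E' where "E' k = real n * p' * forward_diff ((bern_avg (p s) ^^ (n - 1)) (F s)) k
             + (bern_avg (p s) ^^ n) F' k" for k
  have E: "((\<lambda>s. E s k) has_real_derivative E' k) (at s)" for k
    using Suc by (simp add: E_def E'_def)
  have "((\<lambda>s. (1 - p s) * E s k + p s * E s (Suc k)) has_real_derivative
      p' * forward_diff (E s) k + ((1 - p s) * E' k + p s * E' (Suc k))) (at s)"
    by (rule derivative_eq_intros E p refl)+ (simp add: forward_diff_def algebra_simps)
  moreover have "p' * forward_diff (E s) k + ((1 - p s) * E' k + p s * E' (Suc k)) =
      real (Suc n) * p' * forward_diff (E s) k + (bern_avg (p s) ^^ Suc n) F' k"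
    using arg_cong[OF **, of "\<lambda>a. p' * a"]
    by (simp add: bern_avg_def[of "p _" _ k] E_eq[symmetric] E'_def algebra_simps)
  ultimately show ?case
    by (simp add: bern_avg_def[of "p _" _ k] E_eq[symmetric])
qed

section \<open>Generator and tail probabilities of the unconstrained process\<close>

definition generator :: "nat \<Rightarrow> real \<Rightarrow> real \<Rightarrow> (nat \<Rightarrow> real) \<Rightarrow> nat \<Rightarrow> real" where
  "generator N \<nu> \<mu> f x =
     \<mu> * real x * (f (x - 1) - f x) + \<nu> * (real N - real x) * (f (Suc x) - f x)"

text \<open>The probability that, of \<open>N\<close> independent on-off sources with
  \<open>x\<close> of them on at time \<open>0\<close>, at least \<open>C\<close> are on at time
  \<open>s\<close>. With \<open>\<mu> + \<nu> = 1\<close>, a source is on at time \<open>s\<close>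
  with probability \<open>\<nu> + \<mu> * exp (- s)\<close> if it starts on, and
  \<open>\<nu> * (1 - exp (- s))\<close> if it starts off.\<close>

definition tail_prob :: "nat \<Rightarrow> nat \<Rightarrow> real \<Rightarrow> real \<Rightarrow> real \<Rightarrow> nat \<Rightarrow> real" where
  "tail_prob N C \<nu> \<mu> s x =
     (bern_avg (\<nu> + \<mu> * exp (- s)) ^^ x)
       ((bern_avg (\<nu> * (1 - exp (- s))) ^^ (N - x)) (\<lambda>k. if C \<le> k then 1 else 0)) 0"

text \<open>Kolmogorov's backward equation. Both sides are combinations of forward differences with
  one source removed: the time derivative through the derivatives of the two success probabilities,
  the generator because a jump exchanges one source of each kind.\<close>

lemma tail_prob_has_derivative:
  assumes "\<mu> + \<nu> = 1" "x \<le> N"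
  shows "((\<lambda>s. tail_prob N C \<nu> \<mu> s x) has_real_derivative
           generator N \<nu> \<mu> (tail_prob N C \<nu> \<mu> s) x) (at s)"
proof -
  define f :: "nat \<Rightarrow> real" where "f = (\<lambda>k. if C \<le> k then 1 else 0)"
  define p where "p s = \<nu> + \<mu> * exp (- s)" for s
  define q where "q s = \<nu> * (1 - exp (- s))" for s
  define G where "G i j = (bern_avg (p s) ^^ i) ((bern_avg (q s) ^^ j) f)" for i j
  have g: "tail_prob N C \<nu> \<mu> s y = G y (N - y) 0" for y
    by (simp add: tail_prob_def G_def f_def p_def q_def)
  have pd: "(p has_real_derivative - \<mu> * exp (- s)) (at s)"
    unfolding p_def by (auto intro!: derivative_eq_intros)
  have qd: "(q has_real_derivative \<nu> * exp (- s)) (at s)"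
    unfolding q_def by (auto intro!: derivative_eq_intros)
  have pq: "p s - q s = exp (- s)"
    using assms(1) by (simp add: p_def q_def algebra_simps flip: distrib_left)
       (metis distrib_right mult_1)
  have D0: "((\<lambda>s. (bern_avg (q s) ^^ m) f k) has_real_derivative
      real m * (\<nu> * exp (- s)) * forward_diff ((bern_avg (q s) ^^ (m - 1)) f) k) (at s)" for m k
    using bern_avg_funpow_has_derivative[OF qd, of "\<lambda>_. f" "\<lambda>_. 0" m k]
    by (simp add: bern_avg_funpow_const)
  have D1: "((\<lambda>s. tail_prob N C \<nu> \<mu> s x) has_real_derivative
      real x * (- \<mu> * exp (- s)) * forward_diff (G (x - 1) (N - x)) 0
      + (bern_avg (p s) ^^ x) (\<lambda>k. real (N - x) * (\<nu> * exp (- s)) *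
          forward_diff ((bern_avg (q s) ^^ (N - x - 1)) f) k) 0) (at s)"
    using bern_avg_funpow_has_derivative[OF pd D0[of "N - x"], where n=x and k=0]
    by (simp add: tail_prob_def[abs_def] G_def f_def p_def[symmetric] q_def[symmetric])
  have E2: "(bern_avg (p s) ^^ x) (\<lambda>k. real (N - x) * (\<nu> * exp (- s)) *
          forward_diff ((bern_avg (q s) ^^ (N - x - 1)) f) k) 0
     = real (N - x) * (\<nu> * exp (- s)) * forward_diff (G x (N - x - 1)) 0"
    unfolding bern_avg_funpow_cmult G_def by (simp add: bern_avg_funpow_forward_diff[symmetric] eta_contract_eq)
  \<comment> \<open>In \<open>G i j\<close>, \<open>i\<close> sources start on and \<open>j\<close>
    start off. Turning one further source from off to on raises its success probability by
    \<open>p s - q s = exp (- s)\<close>, the factor that also appears in the derivatives of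
    \<open>p\<close> and \<open>q\<close>.\<close>
  have step: "G (Suc i) j k - G i (Suc j) k = exp (- s) * forward_diff (G i j) k" for i j k
    unfolding pq[symmetric] bern_avg_param_diff[symmetric] G_def
    by (simp add: bern_avg_funpow_commute)
  have down: "real x * (G (x - 1) (N - (x - 1)) 0 - G x (N - x) 0) =
      - (real x * exp (- s) * forward_diff (G (x - 1) (N - x)) 0)"
  proof (cases x)
    case (Suc y)
    then have "N - y = Suc (N - x)" using assms(2) by simp
    with Suc step[of y "N - x" 0] show ?thesis by (simp add: algebra_simps)
  qed simp
  have up: "real (N - x) * (G (Suc x) (N - Suc x) 0 - G x (N - x) 0) =
      real (N - x) * exp (- s) * forward_diff (G x (N - x - 1)) 0"
  proof (cases "N - x")
    case (Suc y)
    then have "N - Suc x = y" by simp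
    with Suc step[of x y 0] show ?thesis by (simp add: algebra_simps)
  qed simp
  have "generator N \<nu> \<mu> (tail_prob N C \<nu> \<mu> s) x =
     \<mu> * (real x * (G (x - 1) (N - (x - 1)) 0 - G x (N - x) 0))
     + \<nu> * (real (N - x) * (G (Suc x) (N - Suc x) 0 - G x (N - x) 0))"
    using assms(2) by (simp add: generator_def g of_nat_diff algebra_simps)
  also have "\<dots> = real x * (- \<mu> * exp (- s)) * forward_diff (G (x - 1) (N - x)) 0
      + real (N - x) * (\<nu> * exp (- s)) * forward_diff (G x (N - x - 1)) 0"
    unfolding down up by (simp add: algebra_simps)
  finally show ?thesis using D1 unfolding E2 by simp
qed

lemma engset_probs_in_unit:
  fixes \<mu> \<nu> s :: real
  assumes "0 < \<mu>" "0 < \<nu>" "\<mu> + \<nu> = 1" "0 \<le> s"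
  shows "0 \<le> \<nu> + \<mu> * exp (- s)" "\<nu> + \<mu> * exp (- s) \<le> 1"
    "0 \<le> \<nu> * (1 - exp (- s))" "\<nu> * (1 - exp (- s)) \<le> 1"
proof -
  have e: "0 < exp (- s)" "exp (- s) \<le> 1" using assms by auto
  show "0 \<le> \<nu> + \<mu> * exp (- s)" using assms by simp
  show "\<nu> + \<mu> * exp (- s) \<le> 1"
    using assms mult_left_mono[OF e(2), of \<mu>] by linarith
  show "0 \<le> \<nu> * (1 - exp (- s))" using assms e by simp
  show "\<nu> * (1 - exp (- s)) \<le> 1"
    using assms e mult_mono[of \<nu> 1 "1 - exp (- s)" 1] by simp
qed

lemma tail_prob_bounds:
  assumes "0 < \<mu>" "0 < \<nu>" "\<mu> + \<nu> = 1" "0 \<le> s"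
  shows "0 \<le> tail_prob N C \<nu> \<mu> s x" "tail_prob N C \<nu> \<mu> s x \<le> 1"
proof -
  note p = engset_probs_in_unit[OF assms]
  define f :: "nat \<Rightarrow> real" where "f = (\<lambda>k. if C \<le> k then 1 else 0)"
  define h where "h = (bern_avg (\<nu> * (1 - exp (- s))) ^^ (N - x)) f"
  have "0 \<le> h k" "h k \<le> 1" for k
    using bern_avg_funpow_mono[OF p(3,4), of "\<lambda>_. 0" f] bern_avg_funpow_mono[OF p(3,4), of f "\<lambda>_. 1"]
    by (auto simp: bern_avg_funpow_const h_def f_def)
  then show "0 \<le> tail_prob N C \<nu> \<mu> s x" "tail_prob N C \<nu> \<mu> s x \<le> 1"
    using bern_avg_funpow_mono[OF p(1,2), of "\<lambda>_. 0" h] bern_avg_funpow_mono[OF p(1,2), of h "\<lambda>_. 1"]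
    by (auto simp: bern_avg_funpow_const tail_prob_def h_def f_def)
qed

lemma tail_prob_0: "\<mu> + \<nu> = 1 \<Longrightarrow> tail_prob N C \<nu> \<mu> 0 x = (if C \<le> x then 1 else 0)"
proof -
  assume "\<mu> + \<nu> = 1"
  have A0: "(bern_avg 0 ^^ n) f = f" for n and f :: "nat \<Rightarrow> real"
    by (induction n) (auto simp: bern_avg_def)
  have A1: "(bern_avg 1 ^^ n) f k = f (n + k)" for n k and f :: "nat \<Rightarrow> real"
    by (induction n arbitrary: k) (auto simp: bern_avg_def)
  show ?thesis using \<open>\<mu> + \<nu> = 1\<close> by (simp add: tail_prob_def A0 A1 add.commute[of \<nu>])
qed

text \<open>Mean square error as squared bias plus variance. The constant \<open>v\<close> allows a
  second application with another parameter, in which the first variance takes the place of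
  \<open>v\<close>.\<close>

lemma bern_avg_funpow_square:
  "(bern_avg p ^^ n) (\<lambda>k. (real k - c)\<^sup>2 + v) k =
     (real k + real n * p - c)\<^sup>2 + real n * p * (1 - p) + v"
proof (induction n arbitrary: k)
  case (Suc n)
  show ?case
    unfolding funpow.simps comp_def bern_avg_def[of p _ k] Suc
    by (simp add: power2_eq_square algebra_simps)
qed simp

text \<open>Chebyshev's inequality for the state at time \<open>s\<close> of the process without capacity
  constraint started at \<open>C\<close>, whose mean is \<open>C + (1 - exp (- s)) * (\<nu> * N - C)\<close>.\<close>

lemma tail_prob_from_capacity:
  assumes "0 < \<mu>" "0 < \<nu>" "\<mu> + \<nu> = 1" "0 < s" "C \<le> N" "real C < \<nu> * real N"
  shows "1 - real N / ((1 - exp (- s)) * (\<nu> * real N - real C)\<^sup>2) \<le> tail_prob N C \<nu> \<mu> s C"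
proof -
  define p where "p = \<nu> + \<mu> * exp (- s)"
  define q where "q = \<nu> * (1 - exp (- s))"
  define e where "e = 1 - exp (- s)"
  define m where "m = real C + e * (\<nu> * real N - real C)"
  note pq = engset_probs_in_unit[OF assms(1-3) less_imp_le[OF assms(4)], folded p_def q_def]
  have e: "0 < e" "e \<le> 1" using assms by (auto simp: e_def)
  have p1: "1 - p = \<mu> * e" unfolding p_def e_def using assms(3) by (simp add: algebra_simps)
  have q1: "q = \<nu> * e" unfolding q_def e_def by simp
  have d: "0 < m - real C" using assms e by (simp add: m_def)
  have mean: "real C * p + real (N - C) * q = m"
  proof -
    have p2: "p = 1 - \<mu> * e" "\<mu> = 1 - \<nu>" using p1 assms(3) by auto
    show ?thesis using assms(5) unfolding p2 q1 m_def
      by (simp add: of_nat_diff algebra_simps)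
  qed
  define W where "W = (\<lambda>k. if C \<le> k then 1 else 0 :: real)"
  \<comment> \<open>Chebyshev's inequality pointwise: the indicator lies above a parabola that peaks
    at the mean \<open>m\<close> and vanishes at \<open>C\<close>. The summand \<open>0\<close> is
    the initial \<open>v\<close> of \<open>bern_avg_funpow_square\<close>.\<close>
  have cheb: "1 - ((real k - m)\<^sup>2 + 0) / (m - real C)\<^sup>2 \<le> W k" for k
  proof (cases "C \<le> k")
    case False
    then have "(m - real C)\<^sup>2 \<le> (m - real k)\<^sup>2" using d by (intro power_mono) auto
    moreover have "0 < (m - real C)\<^sup>2" using d by simp
    ultimately have "1 \<le> (real k - m)\<^sup>2 / (m - real C)\<^sup>2"
      by (simp add: le_divide_eq power2_commute)
    with False show ?thesis by (simp add: W_def)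
  qed (simp add: W_def)
  define i where "i = inverse ((m - real C)\<^sup>2)"
  have "(bern_avg p ^^ C) ((bern_avg q ^^ (N - C)) (\<lambda>k. 1 - i * ((real k - m)\<^sup>2 + 0))) 0
     \<le> tail_prob N C \<nu> \<mu> s C"
    unfolding tail_prob_def p_def[symmetric] q_def[symmetric]
    using cheb by (intro bern_avg_funpow_mono pq) (auto simp: W_def i_def field_simps)
  also have "(bern_avg q ^^ (N - C)) (\<lambda>k. 1 - i * ((real k - m)\<^sup>2 + 0)) =
     (\<lambda>k. 1 - i * ((real k - (m - real (N - C) * q))\<^sup>2 + real (N - C) * q * (1 - q)))"
    unfolding fun_eq_iff bern_avg_funpow_diff bern_avg_funpow_const bern_avg_funpow_cmult
      bern_avg_funpow_square by (simp add: algebra_simps)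
  also have "(bern_avg p ^^ C) \<dots> 0
    = 1 - i * ((real C * p + real (N - C) * q - m)\<^sup>2 + real C * p * (1 - p) + real (N - C) * q * (1 - q))"
    unfolding bern_avg_funpow_diff bern_avg_funpow_const bern_avg_funpow_cmult
      bern_avg_funpow_square by (simp add: algebra_simps)
  also have "\<dots> = 1 - (real C * p * (1 - p) + real (N - C) * q * (1 - q)) / (m - real C)\<^sup>2"
    unfolding mean by (simp add: i_def divide_inverse mult.commute)
  finally have *: "1 - (real C * p * (1 - p) + real (N - C) * q * (1 - q)) / (m - real C)\<^sup>2
     \<le> tail_prob N C \<nu> \<mu> s C" .
  \<comment> \<open>Each source contributes variance at most \<open>e\<close>, since
    \<open>1 - p = \<mu> * e\<close> and \<open>q = \<nu> * e\<close>. One factor \<open>e\<close>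
    then cancels against \<open>(m - real C)\<^sup>2\<close>; this gain makes the error vanish even
    for \<open>s\<close> of order \<open>1 / sqrt N\<close>.\<close>
  have "real C * p * (1 - p) \<le> real C * e"
  proof -
    have "p * (1 - p) \<le> 1 * e"
      using p1 pq assms e by (intro mult_mono) auto
    thus ?thesis by (simp add: mult.assoc mult_left_mono)
  qed
  moreover have "real (N - C) * q * (1 - q) \<le> real (N - C) * e"
  proof -
    have "q * (1 - q) \<le> e * 1"
      using q1 pq assms e by (intro mult_mono) auto
    thus ?thesis by (simp add: mult.assoc mult_left_mono)
  qed
  moreover have "real C * e + real (N - C) * e = real N * e"
    using assms(5) by (simp add: of_nat_diff algebra_simps)
  ultimately have "(real C * p * (1 - p) + real (N - C) * q * (1 - q)) / (m - real C)\<^sup>2 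
      \<le> real N * e / (m - real C)\<^sup>2"
    by (intro divide_right_mono) auto
  also have "\<dots> = real N / (e * (\<nu> * real N - real C)\<^sup>2)"
    using e by (simp add: m_def power2_eq_square)
  finally show ?thesis using * unfolding e_def by simp
qed

section \<open>Second-order expansion of the tail probability in time\<close>

lemma generator_bound:
  assumes "0 < \<mu>" "0 < \<nu>" "\<mu> + \<nu> = 1" "x \<le> N" "\<And>y. y \<le> Suc x \<Longrightarrow> \<bar>f y\<bar> \<le> K"
  shows "\<bar>generator N \<nu> \<mu> f x\<bar> \<le> 2 * real N * K"
proof -
  have K: "0 \<le> K" using assms(5)[of x] by linarith
  have b: "\<bar>f (x - 1) - f x\<bar> \<le> 2 * K" "\<bar>f (Suc x) - f x\<bar> \<le> 2 * K"
    using assms(5)[of x] assms(5)[of "x - 1"] assms(5)[of "Suc x"] by fastforce+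
  have "\<bar>generator N \<nu> \<mu> f x\<bar> \<le> \<bar>\<mu> * real x * (f (x - 1) - f x)\<bar> + \<bar>\<nu> * (real N - real x) * (f (Suc x) - f x)\<bar>"
    unfolding generator_def by (rule abs_triangle_ineq)
  also have "\<dots> \<le> \<mu> * real x * (2 * K) + \<nu> * (real N - real x) * (2 * K)"
    using assms b by (intro add_mono) (auto simp: abs_mult intro!: mult_left_mono)
  also have "\<dots> \<le> \<mu> * real N * (2 * K) + \<nu> * real N * (2 * K)"
    using assms K by (intro add_mono mult_right_mono mult_left_mono) auto
  also have "\<dots> = (\<mu> + \<nu>) * (2 * real N * K)" by (simp add: algebra_simps)
  finally show ?thesis using assms by simp
qed

text \<open>By the backward equation the second time derivative is the generator applied twice, and
  each application costs a factor \<open>2 * N\<close>; the mean value theorem is used twice. The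
  condition \<open>x < N\<close> keeps both neighbours of \<open>x\<close> in the range of the
  backward equation.\<close>

lemma tail_prob_taylor:
  assumes "0 < \<mu>" "0 < \<nu>" "\<mu> + \<nu> = 1" "x < N" "0 \<le> s" "0 < h"
  shows "\<bar>tail_prob N C \<nu> \<mu> (s + h) x - tail_prob N C \<nu> \<mu> s x
      - h * generator N \<nu> \<mu> (tail_prob N C \<nu> \<mu> s) x\<bar> \<le> 4 * (real N)\<^sup>2 * h\<^sup>2"
proof -
  let ?g = "tail_prob N C \<nu> \<mu>" and ?L = "generator N \<nu> \<mu>"
  have d1: "((\<lambda>s. ?g s y) has_real_derivative ?L (?g s) y) (at s)" if "y \<le> N" for y s
    using tail_prob_has_derivative assms(3) that by blast
  have d2: "((\<lambda>s. ?L (?g s) x) has_real_derivative ?L (?L (?g s)) x) (at s)" for s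
  proof -
    have "((\<lambda>s. \<mu> * real x * (?g s (x - 1) - ?g s x) + \<nu> * (real N - real x) * (?g s (Suc x) - ?g s x))
        has_real_derivative \<mu> * real x * (?L (?g s) (x - 1) - ?L (?g s) x)
          + \<nu> * (real N - real x) * (?L (?g s) (Suc x) - ?L (?g s) x)) (at s)"
      by (intro DERIV_add DERIV_cmult DERIV_diff d1) (use assms(4) in auto)
    then show ?thesis by (simp only: generator_def[of N \<nu> \<mu> _ x])
  qed
  obtain z where z: "s < z" "z < s + h" "?g (s + h) x - ?g s x = (s + h - s) * ?L (?g z) x"
    using MVT2[of s "s + h" "\<lambda>s. ?g s x" "\<lambda>s. ?L (?g s) x"] d1[of x] assms by auto
  obtain w where w: "s < w" "w < z" "?L (?g z) x - ?L (?g s) x = (z - s) * ?L (?L (?g w)) x"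
    using MVT2[of s z "\<lambda>s. ?L (?g s) x" "\<lambda>s. ?L (?L (?g s)) x"] d2 z by auto
  have "0 \<le> w" using w assms by simp
  \<comment> \<open>At \<open>y = N\<close> the bound involves the state \<open>Suc N\<close>;
    \<open>tail_prob_bounds\<close> holds for every state.\<close>
  have "\<bar>?L (?g w) y\<bar> \<le> 2 * real N * 1" if "y \<le> N" for y
    using tail_prob_bounds[OF assms(1-3) \<open>0 \<le> w\<close>, of N C] that assms
    by (intro generator_bound) (auto simp: abs_le_iff intro: order_trans[of _ 0])
  then have "\<bar>?L (?L (?g w)) x\<bar> \<le> 2 * real N * (2 * real N)"
    using assms by (intro generator_bound) auto
  then have "\<bar>(z - s) * ?L (?L (?g w)) x\<bar> \<le> h * (2 * real N * (2 * real N))"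
    using z w by (auto simp: abs_mult intro!: mult_mono)
  then have "h * \<bar>?L (?g z) x - ?L (?g s) x\<bar> \<le> h * (h * (2 * real N * (2 * real N)))"
    using assms w by (intro mult_left_mono) auto
  moreover have "?g (s + h) x - ?g s x - h * ?L (?g s) x = h * (?L (?g z) x - ?L (?g s) x)"
    using z by (simp add: algebra_simps)
  ultimately show ?thesis
    using assms by (simp add: abs_mult power2_eq_square mult_ac)
qed

section \<open>Central limit theorem for the unconstrained process\<close>

text \<open>Conditioning on one Bernoulli trial is one application of \<open>bern_avg\<close>. The
  offset \<open>k\<close> makes the induction go through, as a success shifts it.\<close>

lemma expectation_binomial_bern_avg:
  fixes f :: "nat \<Rightarrow> 'b::{banach, second_countable_topology}"
  assumes p: "p \<in> {0..1}"
  shows "measure_pmf.expectation (binomial_pmf n p) (\<lambda>j. f (k + j)) = (bern_avg p ^^ n) f k"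
proof (induction n arbitrary: k)
  case 0
  show ?case using p by (simp add: binomial_pmf_0)
next
  case (Suc n)
  have "measure_pmf.expectation (binomial_pmf (Suc n) p) (\<lambda>j. f (k + j)) =
    (\<Sum>b\<in>UNIV. pmf (bernoulli_pmf p) b *\<^sub>R
       measure_pmf.expectation (binomial_pmf n p \<bind> (\<lambda>j. return_pmf ((if b then 1 else 0) + j)))
         (\<lambda>j. f (k + j)))"
    unfolding binomial_pmf_Suc[OF p]
    by (rule pmf_expectation_bind) (use p finite_set_pmf_binomial_pmf[OF p, of n] in auto)
  also have "\<dots> = (1 - p) *\<^sub>R (bern_avg p ^^ n) f k + p *\<^sub>R (bern_avg p ^^ n) f (Suc k)"
    using p Suc[of k] Suc[of "Suc k"]
    by (simp add: UNIV_bool map_pmf_def[symmetric])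
  finally show ?case by (simp add: bern_avg_def[of p _ k])
qed

text \<open>From state \<open>0\<close> every source starts off, so a single binomial law
  remains.\<close>

lemma tail_prob_eq_binomial:
  assumes "0 < \<mu>" "0 < \<nu>" "\<mu> + \<nu> = 1" "0 \<le> s"
  shows "tail_prob N C \<nu> \<mu> s 0 = measure_pmf.prob (binomial_pmf N (\<nu> * (1 - exp (- s)))) {C..}"
proof -
  have p: "\<nu> * (1 - exp (- s)) \<in> {0..1}" using engset_probs_in_unit[OF assms] by auto
  have "tail_prob N C \<nu> \<mu> s 0 =
      measure_pmf.expectation (binomial_pmf N (\<nu> * (1 - exp (- s)))) (\<lambda>j. if C \<le> 0 + j then 1 else 0)"
    by (subst expectation_binomial_bern_avg[OF p, of N "\<lambda>k. if C \<le> k then 1 else 0" 0])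
       (simp add: tail_prob_def)
  also have "(\<lambda>j. if C \<le> 0 + j then 1 else 0 :: real) = indicator {C..}"
    by (auto simp: indicator_def)
  finally show ?thesis by simp
qed

text \<open>Exponentials are eigenfunctions of \<open>bern_avg p\<close>; the eigenvalue is the
  Bernoulli characteristic function.\<close>

lemma bern_avg_funpow_iexp:
  "(bern_avg p ^^ n) (\<lambda>k. iexp (a + t * real k)) k =
     iexp (a + t * real k) * (complex_of_real (1 - p) + complex_of_real p * iexp t) ^ n"
proof (induction n arbitrary: k)
  case (Suc n)
  have "iexp (a + t * real (Suc k)) = iexp (a + t * real k) * iexp t"
    by (simp add: exp_add[symmetric] algebra_simps)
  then show ?case
    unfolding funpow.simps comp_def bern_avg_def[of p _ k] Suc
    by (simp add: scaleR_conv_of_real algebra_simps)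
qed simp

lemma iexp_quadratic_error: "cmod (iexp x - (1 + \<i> * x - x\<^sup>2 / 2)) \<le> \<bar>x\<bar> ^ 3"
proof -
  have "cmod (iexp x - (\<Sum>k\<le>2. (\<i> * x)^k / fact k)) \<le> \<bar>x\<bar> ^ Suc 2 / fact (Suc 2)"
    by (rule iexp_approx1)
  also have "(\<Sum>k\<le>2. (\<i> * complex_of_real x)^k / fact k) = 1 + \<i> * x - x\<^sup>2 / 2"
    by (simp add: numeral_2_eq_2 power_mult_distrib)
  also have "\<bar>x\<bar> ^ Suc 2 / fact (Suc 2) = \<bar>x\<bar> ^ 3 / 6"
    by (simp add: eval_nat_numeral)
  also have "\<dots> \<le> \<bar>x\<bar> ^ 3" by simp
  finally show ?thesis .
qed

text \<open>A centred Bernoulli variable is \<open>- p\<close> with probability \<open>1 - p\<close>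
  and \<open>1 - p\<close> with probability \<open>p\<close>. In the quadratic expansions at these
  two points the linear terms cancel and the quadratic ones give the variance. The error is uniform
  in \<open>p\<close>, as needed when \<open>p\<close> changes with the number of trials.\<close>

lemma centered_bernoulli_char_error:
  assumes "0 \<le> p" "p \<le> 1"
  shows "cmod (iexp (- t * p) * (complex_of_real (1 - p) + complex_of_real p * iexp t)
           - complex_of_real (1 - t\<^sup>2 * p * (1 - p) / 2)) \<le> \<bar>t\<bar> ^ 3"
proof -
  define E where "E x = iexp x - (1 + \<i> * complex_of_real x - (complex_of_real x)\<^sup>2 / 2)" for x
  have E: "cmod (E x) \<le> \<bar>x\<bar> ^ 3" for x unfolding E_def using iexp_quadratic_error[of x] by simp
  have "iexp (- t * p) * (complex_of_real (1 - p) + complex_of_real p * iexp t) =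
     complex_of_real (1 - p) * iexp (- t * p) + complex_of_real p * iexp (t * (1 - p))"
    by (simp add: exp_add[symmetric] algebra_simps flip: exp_minus)
  also have "\<dots> - complex_of_real (1 - t\<^sup>2 * p * (1 - p) / 2) =
     complex_of_real (1 - p) * E (- t * p) + complex_of_real p * E (t * (1 - p))"
    by (simp add: E_def field_simps power2_eq_square)
  also have "cmod \<dots> \<le> (1 - p) * \<bar>t\<bar> ^ 3 + p * \<bar>t\<bar> ^ 3"
  proof (rule order_trans[OF norm_triangle_ineq], intro add_mono)
    have "\<bar>- t * p\<bar> ^ 3 \<le> \<bar>t\<bar> ^ 3" "\<bar>t * (1 - p)\<bar> ^ 3 \<le> \<bar>t\<bar> ^ 3"
      using assms by (auto intro!: power_mono simp: abs_mult mult_left_le)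
    then have "cmod (E (- t * p)) \<le> \<bar>t\<bar> ^ 3" "cmod (E (t * (1 - p))) \<le> \<bar>t\<bar> ^ 3"
      using E order_trans by blast+
    then show "cmod (complex_of_real (1 - p) * E (- t * p)) \<le> (1 - p) * \<bar>t\<bar> ^ 3"
      "cmod (complex_of_real p * E (t * (1 - p))) \<le> p * \<bar>t\<bar> ^ 3"
      using assms unfolding norm_mult norm_of_real by (auto intro!: mult_left_mono)
  qed
  also have "\<dots> = \<bar>t\<bar> ^ 3" by (simp add: algebra_simps)
  finally show ?thesis .
qed

text \<open>For bases of modulus at most \<open>1\<close>, the \<open>n\<close>-th powers differ by
  at most \<open>n\<close> times the difference of the bases, here by
  \<open>\<bar>c n - l\<bar>\<close>; so \<open>c n\<close> may be replaced by its limit. Positivity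
  of \<open>l\<close> keeps the bases below \<open>1\<close> eventually.\<close>

lemma power_one_minus_tendsto_exp:
  fixes c :: "nat \<Rightarrow> real"
  assumes c: "c \<longlonglongrightarrow> l" and l: "0 < l"
  shows "(\<lambda>n. (1 - c n / real n) ^ n) \<longlonglongrightarrow> exp (- l)"
proof -
  have lim: "(\<lambda>n. (1 + (- l) / real n) ^ n) \<longlonglongrightarrow> exp (- l)"
    by (rule tendsto_exp_limit_sequentially)
  have small: "\<forall>\<^sub>F n in sequentially. \<bar>1 - d n / real n\<bar> \<le> 1"
    if "d \<longlonglongrightarrow> L" "0 < L" for d :: "nat \<Rightarrow> real" and L
  proof -
    have "(\<lambda>n. d n / real n) \<longlonglongrightarrow> 0"
      by (rule tendsto_divide_0[OF that(1)])
         (simp add: filterlim_real_sequentially filterlim_at_top_imp_at_infinity)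
    from order_tendstoD(2)[OF this zero_less_one] order_tendstoD(1)[OF that]
    show ?thesis
      by eventually_elim (simp add: abs_le_iff)
  qed
  have "(\<lambda>n. (1 - c n / real n) ^ n - (1 + (- l) / real n) ^ n) \<longlonglongrightarrow> 0"
  proof (rule Lim_null_comparison)
    show "(\<lambda>n. \<bar>c n - l\<bar>) \<longlonglongrightarrow> 0"
      using c by (simp add: tendsto_rabs_zero_iff LIM_zero_iff)
    show "\<forall>\<^sub>F n in sequentially. norm ((1 - c n / real n) ^ n - (1 + (- l) / real n) ^ n) \<le> \<bar>c n - l\<bar>"
      using small[OF c l] small[OF tendsto_const l] eventually_gt_at_top[of 0]
    proof eventually_elim
      case (elim n)
      have "norm ((1 - c n / real n) ^ n - (1 - l / real n) ^ n)
          \<le> real n * norm ((1 - c n / real n) - (1 - l / real n))"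
        using elim by (intro norm_power_diff) auto
      also have "(1 - c n / real n) - (1 - l / real n) = - ((c n - l) / real n)"
        by (simp add: diff_divide_distrib)
      also have "real n * norm (- ((c n - l) / real n)) = \<bar>c n - l\<bar>"
        using elim by simp
      finally show ?case by simp
    qed
  qed
  from Lim_transform[OF lim this] show ?thesis .
qed


text \<open>The same comparison of powers replaces the characteristic function of one trial by its
  quadratic approximation, at a total cost of \<open>n * \<bar>w / sqrt n\<bar> ^ 3\<close>, which
  is of order \<open>1 / sqrt n\<close>.\<close>

lemma centered_binomial_char_tendsto:
  fixes p :: "nat \<Rightarrow> real"
  assumes "p \<longlonglongrightarrow> \<eta>" "0 < \<eta>" "\<eta> < 1"
  shows "(\<lambda>n. (iexp (- (w / sqrt n) * p n) *
            (complex_of_real (1 - p n) + complex_of_real (p n) * iexp (w / sqrt n))) ^ n)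
         \<longlonglongrightarrow> complex_of_real (exp (- (w\<^sup>2 * \<eta> * (1 - \<eta>) / 2)))"
proof (cases "w = 0")
  \<comment> \<open>For \<open>w = 0\<close> the limit \<open>l\<close> in
    \<open>power_one_minus_tendsto_exp\<close> would not be positive.\<close>
  case True
  then show ?thesis by simp
next
  case False
  define z where "z n = iexp (- (w / sqrt n) * p n) *
            (complex_of_real (1 - p n) + complex_of_real (p n) * iexp (w / sqrt n))" for n
  define c where "c n = w\<^sup>2 * p n * (1 - p n) / 2" for n
  have ev: "\<forall>\<^sub>F n in sequentially. 0 \<le> p n \<and> p n \<le> 1"
    using order_tendstoD(1)[OF assms(1,2)] order_tendstoD(2)[OF assms(1,3)]
    by eventually_elim auto
  have cl: "c \<longlonglongrightarrow> w\<^sup>2 * \<eta> * (1 - \<eta>) / 2"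
    unfolding c_def by (intro tendsto_intros assms) auto
  have c0: "(\<lambda>n. c n / real n) \<longlonglongrightarrow> 0"
    by (rule tendsto_divide_0[OF cl]) (simp add: filterlim_real_sequentially filterlim_at_top_imp_at_infinity)
  have evc: "\<forall>\<^sub>F n in sequentially. \<bar>c n / real n\<bar> \<le> 1"
    using tendsto_rabs[OF c0] by (auto dest!: order_tendstoD(2)[of _ _ _ 1] elim: eventually_mono)
  have err: "(\<lambda>n. real n * \<bar>w / sqrt n\<bar> ^ 3) \<longlonglongrightarrow> 0"
  proof -
    have "(\<lambda>n. \<bar>w\<bar> ^ 3 / sqrt n) \<longlonglongrightarrow> 0"
      by (rule tendsto_divide_0[OF tendsto_const])
         (intro filterlim_at_top_imp_at_infinity filterlim_compose[OF sqrt_at_top filterlim_real_sequentially])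
    moreover have "\<forall>\<^sub>F n in sequentially. \<bar>w\<bar> ^ 3 / sqrt n = real n * \<bar>w / sqrt n\<bar> ^ 3"
      using eventually_gt_at_top[of 0]
    proof eventually_elim
      case (elim n)
      have "sqrt (real n) ^ 3 = real n * sqrt (real n)" by (simp add: power3_eq_cube)
      then show ?case using elim by (simp add: abs_divide power_divide)
    qed
    ultimately show ?thesis by (rule Lim_transform_eventually)
  qed
  have "(\<lambda>n. z n ^ n - complex_of_real (1 - c n / real n) ^ n) \<longlonglongrightarrow> 0"
  proof (rule Lim_null_comparison[OF _ err])
    show "\<forall>\<^sub>F n in sequentially. norm (z n ^ n - complex_of_real (1 - c n / real n) ^ n)
         \<le> real n * \<bar>w / sqrt n\<bar> ^ 3"
      using ev evc eventually_gt_at_top[of 0]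
    proof eventually_elim
      case (elim n)
      have cn: "0 \<le> c n" using elim by (simp add: c_def)
      have "cmod (complex_of_real (1 - p n) + complex_of_real (p n) * iexp (w / sqrt n)) \<le> (1 - p n) + p n * 1"
        using elim by (intro order_trans[OF norm_triangle_ineq] add_mono) (auto simp: norm_mult simp del: of_real_diff)
      then have z1: "cmod (z n) \<le> 1"
        by (simp add: z_def norm_mult)
      have "cmod (complex_of_real (1 - c n / real n)) \<le> 1"
        unfolding norm_of_real using elim cn by auto
      then have "cmod (z n ^ n - complex_of_real (1 - c n / real n) ^ n)
          \<le> real n * cmod (z n - complex_of_real (1 - c n / real n))"
        by (intro norm_power_diff z1)
      moreover have "c n / real n = (w / sqrt n)\<^sup>2 * p n * (1 - p n) / 2"
        using elim by (simp add: c_def power_divide)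
      moreover from this have "cmod (z n - complex_of_real (1 - c n / real n)) \<le> \<bar>w / sqrt n\<bar> ^ 3"
        unfolding z_def using elim
        by (simp only: \<open>c n / real n = _\<close>) (intro centered_bernoulli_char_error; simp)
      ultimately show ?case
        by (meson mult_left_mono of_nat_0_le_iff order_trans)
    qed
  qed
  moreover have "(\<lambda>n. complex_of_real (1 - c n / real n) ^ n)
      \<longlonglongrightarrow> complex_of_real (exp (- (w\<^sup>2 * \<eta> * (1 - \<eta>) / 2)))"
    unfolding of_real_power[symmetric] by (intro tendsto_of_real power_one_minus_tendsto_exp cl) (use assms False in auto)
  ultimately show ?thesis unfolding z_def[symmetric] by (rule Lim_transform[rotated])
qed

text \<open>The law is the image of the standard normal law under multiplication by
  \<open>sqrt v\<close>, which yields the characteristic function; having a density, it has no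
  atoms, so its distribution function is continuous.\<close>

lemma centered_normal_props:
  assumes "0 < v"
  shows "real_distribution (centered_normal v)"
    and "char (centered_normal v) = (\<lambda>t. complex_of_real (exp (- (v * t\<^sup>2 / 2))))"
    and "isCont (cdf (centered_normal v)) x"
proof -
  interpret S: prob_space std_normal_distribution
    using real_dist_normal_dist real_distribution.axioms(1) by blast
  have "distributed std_normal_distribution lborel (\<lambda>x. 0 + sqrt v * x) (normal_density (0 + sqrt v * 0) (\<bar>sqrt v\<bar> * 1))"
    by (rule S.normal_density_affine)
       (use assms in \<open>auto simp: distributed_def distr_id2\<close>)
  then have D: "distr std_normal_distribution borel (\<lambda>x. sqrt v * x) = centered_normal v"
    using assms by (auto simp: distributed_def centered_normal_def cong: distr_cong)
  interpret real_distribution std_normal_distribution by (rule real_dist_normal_dist)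
  have m: "(\<lambda>x. sqrt v * x) \<in> borel_measurable std_normal_distribution" by simp
  show r: "real_distribution (centered_normal v)"
    unfolding D[symmetric] using m by (rule S.real_distribution_distr)
  show "char (centered_normal v) = (\<lambda>t. complex_of_real (exp (- (v * t\<^sup>2 / 2))))"
  proof
    fix t
    have "char (centered_normal v) t = char std_normal_distribution (t * sqrt v)"
      unfolding D[symmetric] char_def by (subst integral_distr) (auto simp: mult_ac)
    also have "\<dots> = complex_of_real (exp (- (v * t\<^sup>2 / 2)))"
      using assms by (simp add: char_std_normal_distribution power_mult_distrib mult.commute)
    finally show "char (centered_normal v) t = complex_of_real (exp (- (v * t\<^sup>2 / 2)))" .
  qed
  interpret C: real_distribution "centered_normal v" by (rule r)
  have "emeasure (centered_normal v) {x} = 0"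
    unfolding centered_normal_def
    by (subst emeasure_density) (auto simp: nn_integral_null_set)
  then show "isCont (cdf (centered_normal v)) x"
    by (simp add: C.isCont_cdf measure_def)
qed

text \<open>Levy's continuity theorem, with success probabilities that vary with \<open>n\<close>,
  applied to the decreasing affine function \<open>V n\<close> of the binomial variable. It is
  chosen so that \<open>C n \<le> k\<close> becomes \<open>V n k \<le> y\<close>; a tail probability
  is then a distribution function at the fixed point \<open>y\<close>.\<close>

lemma binomial_lattice_clt:
  fixes p :: "nat \<Rightarrow> real" and C :: "nat \<Rightarrow> nat"
  assumes \<eta>: "p \<longlonglongrightarrow> \<eta>" "0 < \<eta>" "\<eta> < 1" and "0 < r"
    and shift: "(\<lambda>n. (real (C n) - n * p n) / sqrt n) \<longlonglongrightarrow> - (y * r)"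
  shows "(\<lambda>n. measure_pmf.prob (binomial_pmf n (p n)) {C n..})
          \<longlonglongrightarrow> cdf (centered_normal (\<eta> * (1 - \<eta>) / r\<^sup>2)) y"
proof -
  define v where "v = \<eta> * (1 - \<eta>) / r\<^sup>2"
  have v: "0 < v" using assms by (simp add: v_def)
  define V where "V n k = y + (real (C n) - real k) / (sqrt n * r)" for n k
  define D where "D n = distr (measure_pmf (binomial_pmf n (p n))) borel (V n)" for n
  have ev: "\<forall>\<^sub>F n in sequentially. p n \<in> {0..1}"
    using order_tendstoD(1)[OF assms(1,2)] order_tendstoD(2)[OF assms(1,3)]
    by eventually_elim auto
  have "weak_conv_m D (centered_normal v)"
  proof (rule levy_continuity)
    show "real_distribution (D n)" for n
      unfolding D_def by (intro prob_space.real_distribution_distr prob_space_measure_pmf) simp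
    show "real_distribution (centered_normal v)" using centered_normal_props(1)[OF v] .
    fix u :: real
    \<comment> \<open>\<open>u * V n k\<close> splits into \<open>w / sqrt n * (k - n * p n)\<close>
      and the deterministic term \<open>b n\<close>, which tends to \<open>0\<close> by
      \<open>shift\<close>.\<close>
    define w where "w = - (u / r)"
    define b where "b n = u * (y + ((real (C n) - n * p n) / sqrt n) / r)" for n
    have b0: "b \<longlonglongrightarrow> 0"
    proof -
      have "b \<longlonglongrightarrow> u * (y + (- (y * r)) / r)"
        unfolding b_def by (intro tendsto_intros shift) (use assms in auto)
      then show ?thesis using \<open>0 < r\<close> by simp
    qed
    have ch: "\<forall>\<^sub>F n in sequentially. iexp (b n) * (iexp (- (w / sqrt n) * p n) *
            (complex_of_real (1 - p n) + complex_of_real (p n) * iexp (w / sqrt n))) ^ n = char (D n) u"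
      using ev eventually_gt_at_top[of 0]
    proof eventually_elim
      case (elim n)
      define a where "a = u * (y + real (C n) / (sqrt n * r))"
      have "char (D n) u = measure_pmf.expectation (binomial_pmf n (p n)) (\<lambda>k. iexp (u * V n k))"
        unfolding char_def D_def by (subst integral_distr) auto
      also have "(\<lambda>k. iexp (u * V n k)) = (\<lambda>k. iexp (a + w / sqrt n * real k))"
      proof
        fix k
        have "u * V n k = a + w / sqrt n * real k"
          using assms elim by (simp add: V_def a_def w_def field_simps)
        then show "iexp (u * V n k) = iexp (a + w / sqrt n * real k)" by (rule arg_cong)
      qed
      also have "measure_pmf.expectation (binomial_pmf n (p n)) \<dots> =
          iexp a * (complex_of_real (1 - p n) + complex_of_real (p n) * iexp (w / sqrt n)) ^ n"
        using expectation_binomial_bern_avg[OF elim(1), of n "\<lambda>k. iexp (a + w / sqrt n * real k)" 0]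
        unfolding bern_avg_funpow_iexp by simp
      also have "iexp a = iexp (b n) * iexp (- (w / sqrt n) * p n) ^ n"
      proof -
        have "a = b n + n * (- (w / sqrt n) * p n)"
          unfolding a_def b_def w_def using assms elim by (simp add: field_simps)
        then have "\<i> * complex_of_real a = \<i> * b n + of_nat n * (\<i> * complex_of_real (- (w / sqrt n) * p n))"
          by (simp only: of_real_add of_real_mult of_real_of_nat_eq ring_distribs mult.left_commute)
        then show ?thesis
          by (simp only: exp_add exp_of_nat_mult)
      qed
      finally show ?case by (simp add: power_mult_distrib)
    qed
    have "(\<lambda>n. iexp (b n) * (iexp (- (w / sqrt n) * p n) *
            (complex_of_real (1 - p n) + complex_of_real (p n) * iexp (w / sqrt n))) ^ n)
        \<longlonglongrightarrow> iexp 0 * complex_of_real (exp (- (w\<^sup>2 * \<eta> * (1 - \<eta>) / 2)))"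
      by (intro tendsto_intros b0 centered_binomial_char_tendsto assms)
    also have "iexp 0 * complex_of_real (exp (- (w\<^sup>2 * \<eta> * (1 - \<eta>) / 2))) = char (centered_normal v) u"
      unfolding centered_normal_props(2)[OF v]
      by (simp add: w_def v_def power_divide mult_ac del: of_real_exp)
    finally show "(\<lambda>n. char (D n) u) \<longlonglongrightarrow> char (centered_normal v) u"
      using ch by (rule Lim_transform_eventually)
  qed
  then have "(\<lambda>n. cdf (D n) y) \<longlonglongrightarrow> cdf (centered_normal v) y"
    using centered_normal_props(3)[OF v] by (simp add: weak_conv_m_def weak_conv_def)
  moreover have "\<forall>\<^sub>F n in sequentially. cdf (D n) y = measure_pmf.prob (binomial_pmf n (p n)) {C n..}"
    using eventually_gt_at_top[of 0]
  proof eventually_elim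
    case (elim n)
    have "0 < sqrt n * r" using elim \<open>0 < r\<close> by simp
    then have "V n -` {..y} = {C n..}"
      by (auto simp: V_def divide_le_0_iff simp del: zero_less_mult_iff)
    then show ?case by (simp add: cdf_def D_def measure_distr)
  qed
  ultimately show ?thesis unfolding v_def by (rule Lim_transform_eventually)
qed

text \<open>At the chosen time the success probability is
  \<open>\<eta> + (\<nu> - \<eta>) * y / sqrt N\<close> to first order, so
  \<open>C N - N * p N\<close> is asymptotically \<open>- (\<nu> - \<eta>) * y * sqrt N\<close>; the
  bounded deviation of \<open>C N\<close> from \<open>\<eta> * N\<close> disappears after division
  by \<open>sqrt N\<close>.\<close>

lemma tail_prob_clt:
  fixes C :: "nat \<Rightarrow> nat"
  assumes "0 < \<mu>" "0 < \<nu>" "\<mu> + \<nu> = 1" "0 < \<eta>" "\<eta> < \<nu>"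
    and C: "(\<lambda>N. real (C N) - \<eta> * real N) \<in> O(\<lambda>_. 1)"
  shows "(\<lambda>N. tail_prob N (C N) \<nu> \<mu> (ln (\<nu> / (\<nu> - \<eta>)) + y / sqrt N) 0)
          \<longlonglongrightarrow> cdf (centered_normal (\<eta> * (1 - \<eta>) / (\<nu> - \<eta>)\<^sup>2)) y"
proof -
  define t where "t = ln (\<nu> / (\<nu> - \<eta>))"
  define p where "p N = \<nu> * (1 - exp (- (t + y / sqrt (real N))))" for N :: nat
  \<comment> \<open>At time \<open>t\<close> the expected fraction of active sources,
    \<open>\<nu> * (1 - exp (- t))\<close>, equals \<open>\<eta>\<close>.\<close>
  have et: "exp (- t) = (\<nu> - \<eta>) / \<nu>" using assms by (simp add: t_def exp_minus)
  have t: "0 < t" using assms by (simp add: t_def)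
  have p_eq: "p N = \<nu> - (\<nu> - \<eta>) * exp (- (y / sqrt N))" for N
  proof -
    have "exp (- (t + y / sqrt N)) = (\<nu> - \<eta>) / \<nu> * exp (- (y / sqrt N))"
      unfolding et[symmetric] exp_add[symmetric] by simp
    then have "\<nu> * exp (- (t + y / sqrt N)) = (\<nu> - \<eta>) * exp (- (y / sqrt N))"
      using assms by (simp only:) simp
    then show ?thesis unfolding p_def right_diff_distrib by simp
  qed
  have y0: "(\<lambda>N. y / sqrt (real N)) \<longlonglongrightarrow> 0"
    by (rule tendsto_divide_0[OF tendsto_const])
       (intro filterlim_at_top_imp_at_infinity filterlim_compose[OF sqrt_at_top filterlim_real_sequentially])
  have p_lim: "p \<longlonglongrightarrow> \<eta>"
  proof -
    have "(\<lambda>N. \<nu> - (\<nu> - \<eta>) * exp (- (y / sqrt (real N)))) \<longlonglongrightarrow> \<nu> - (\<nu> - \<eta>) * exp (- 0)"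
      by (intro tendsto_intros y0)
    then show ?thesis by (simp add: p_eq[abs_def])
  qed
  have "(\<lambda>N. (real (C N) - N * p N) / sqrt N) \<longlonglongrightarrow> - (y * (\<nu> - \<eta>))"
  proof -
    obtain K where K: "\<forall>\<^sub>F N in sequentially. norm (real (C N) - \<eta> * real N) \<le> K * norm (1::real)"
      using C by (auto elim!: landau_o.bigE)
    have 1: "(\<lambda>N. (real (C N) - \<eta> * real N) / sqrt N) \<longlonglongrightarrow> 0"
    proof (rule Lim_null_comparison)
      show "\<forall>\<^sub>F N in sequentially. norm ((real (C N) - \<eta> * real N) / sqrt N) \<le> K / sqrt N"
        using K by eventually_elim (simp add: divide_right_mono)
      show "(\<lambda>N. K / sqrt (real N)) \<longlonglongrightarrow> 0"
        by (rule tendsto_divide_0[OF tendsto_const])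
           (intro filterlim_at_top_imp_at_infinity filterlim_compose[OF sqrt_at_top filterlim_real_sequentially])
    qed
    have 2: "(\<lambda>N. sqrt (real N) * (1 - exp (- (y / sqrt (real N))))) \<longlonglongrightarrow> y"
      by real_asymp
    have "(\<lambda>N. (real (C N) - \<eta> * real N) / sqrt N
             - (\<nu> - \<eta>) * (sqrt (real N) * (1 - exp (- (y / sqrt (real N)))))) \<longlonglongrightarrow> 0 - (\<nu> - \<eta>) * y"
      by (intro tendsto_intros 1 2)
    moreover have "\<forall>\<^sub>F N in sequentially. (real (C N) - \<eta> * real N) / sqrt N
             - (\<nu> - \<eta>) * (sqrt (real N) * (1 - exp (- (y / sqrt (real N))))) = (real (C N) - N * p N) / sqrt N"
      using eventually_gt_at_top[of 0]
    proof eventually_elim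
      case (elim N)
      have "real N * p N = \<eta> * real N + (\<nu> - \<eta>) * (1 - exp (- (y / sqrt (real N)))) * real N"
        by (simp add: p_eq algebra_simps)
      then have "(real (C N) - N * p N) / sqrt N = (real (C N) - \<eta> * real N) / sqrt N
          - (\<nu> - \<eta>) * ((1 - exp (- (y / sqrt (real N)))) * (real N / sqrt N))"
        by (simp add: diff_divide_distrib add_divide_distrib)
      then show ?case by (simp only: real_div_sqrt of_nat_0_le_iff mult.commute[of _ "sqrt (real N)"])
    qed
    ultimately show ?thesis by (auto dest: Lim_transform_eventually simp: mult.commute)
  qed
  then have "(\<lambda>N. measure_pmf.prob (binomial_pmf N (p N)) {C N..})
      \<longlonglongrightarrow> cdf (centered_normal (\<eta> * (1 - \<eta>) / (\<nu> - \<eta>)\<^sup>2)) y"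
    using assms p_lim by (intro binomial_lattice_clt) auto
  \<comment> \<open>For negative \<open>y\<close> the time is nonnegative only for large
    \<open>N\<close>, and only then is the tail probability identified with the binomial
    one.\<close>
  moreover have "\<forall>\<^sub>F N in sequentially. measure_pmf.prob (binomial_pmf N (p N)) {C N..} =
       tail_prob N (C N) \<nu> \<mu> (t + y / sqrt N) 0"
  proof -
    have "(\<lambda>N. t + y / sqrt (real N)) \<longlonglongrightarrow> t + 0" by (intro tendsto_intros y0)
    then have "\<forall>\<^sub>F N in sequentially. 0 < t + y / sqrt (real N)"
      using t order_tendstoD(1)[of _ t _ 0] by simp
    then show ?thesis
      by eventually_elim (use assms in \<open>simp add: tail_prob_eq_binomial p_def\<close>)
  qed
  ultimately show ?thesis unfolding t_def by (rule Lim_transform_eventually)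
qed

section \<open>Hitting probabilities on a time grid\<close>

text \<open>For a stochastic kernel \<open>K\<close> on \<open>S\<close>, the probability that the
  chain started at \<open>x\<close> visits \<open>c\<close> at one of the times
  \<open>0, ..., k\<close>, computed by conditioning on the first step.\<close>

fun grid_hit :: "nat set \<Rightarrow> (nat \<Rightarrow> nat \<Rightarrow> real) \<Rightarrow> nat \<Rightarrow> nat \<Rightarrow> nat \<Rightarrow> real" where
  "grid_hit S K c 0 x = (if x = c then 1 else 0)"
| "grid_hit S K c (Suc k) x = (if x = c then 1 else \<Sum>y\<in>S. K x y * grid_hit S K c k y)"

text \<open>Strictly below \<open>C\<close> no upward rate is cut off, so the Engset and the
  unconstrained generator agree. At \<open>x = 0\<close> the truncated \<open>x - 1\<close> carries
  rate \<open>0\<close>.\<close>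

lemma generator_eq_engset_sum:
  assumes "x < C"
  shows "(\<Sum>y\<in>{0..C}. engset_rate N C \<nu> \<mu> x y * (f y - f x)) = generator N \<nu> \<mu> f x"
proof -
  have "(\<Sum>y\<in>{0..C}. engset_rate N C \<nu> \<mu> x y * (f y - f x)) =
     (\<Sum>y\<in>{0..C}. if y = x - 1 then \<mu> * real x * (f (x - 1) - f x) else 0)
     + (\<Sum>y\<in>{0..C}. if y = Suc x then \<nu> * (real N - real x) * (f (Suc x) - f x) else 0)"
    unfolding sum.distrib[symmetric]
    by (rule sum.cong) (use assms in \<open>auto simp: engset_rate_def\<close>)
  moreover have "x - 1 \<in> {0..C}" "Suc x \<in> {0..C}" using assms by auto
  ultimately show ?thesis by (simp only: sum.delta finite_atLeastAtMost if_True generator_def)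
qed

text \<open>Below \<open>C\<close>, one step of \<open>P h\<close> and an advance of the tail
  probability by time \<open>h\<close> have the same first-order term, \<open>h\<close> times the
  generator. The error is uniform in the time \<open>s\<close> because tail probabilities lie in the
  unit interval, and in \<open>x\<close> because there are finitely many states.\<close>

lemma tail_prob_one_step_error:
  assumes par: "0 < \<mu>" "0 < \<nu>" "\<mu> + \<nu> = 1" "C \<le> N"
    and P: "transition_function {0..C} P" "has_transition_rates {0..C} P (engset_rate N C \<nu> \<mu>)"
    and "0 < \<epsilon>"
  shows "\<forall>\<^sub>F h in at_right 0. \<forall>s\<ge>0. \<forall>x<C.
      \<bar>tail_prob N C \<nu> \<mu> (s + h) x - (\<Sum>y\<in>{0..C}. P h x y * tail_prob N C \<nu> \<mu> s y)\<bar> \<le> \<epsilon> * h"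
proof -
  let ?g = "tail_prob N C \<nu> \<mu>" and ?q = "engset_rate N C \<nu> \<mu>"
  define e where "e h = (\<Sum>x\<in>{0..C}. \<Sum>y\<in>{0..C}. if x = y then 0 else \<bar>P h x y / h - ?q x y\<bar>)
      + 4 * (real N)\<^sup>2 * h" for h
  have "((\<lambda>h. if x = y then 0 else \<bar>P h x y / h - ?q x y\<bar>) \<longlongrightarrow> 0) (at_right 0)"
    if "x \<in> {0..C}" "y \<in> {0..C}" for x y
    using P(2) that
    by (cases "x = y") (auto simp: has_transition_rates_def tendsto_rabs_zero_iff LIM_zero_iff)
  then have "(e \<longlongrightarrow> (\<Sum>x\<in>{0..C}. \<Sum>y\<in>{0..C}. 0) + 4 * (real N)\<^sup>2 * 0) (at_right 0)"
    unfolding e_def by (intro tendsto_intros) auto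
  then have "(e \<longlongrightarrow> 0) (at_right 0)" by simp
  then have "\<forall>\<^sub>F h in at_right 0. e h < \<epsilon>"
    using order_tendstoD(2) \<open>0 < \<epsilon>\<close> by blast
  then show ?thesis using eventually_at_right_less[of 0]
  proof eventually_elim
    case (elim h)
    show ?case
    proof (intro allI impI)
      fix s :: real and x assume s: "0 \<le> s" and x: "x < C"
      have h: "0 < h" using elim by simp
      have rows: "(\<Sum>y\<in>{0..C}. P h x y) = 1"
        using P(1) x h by (auto simp: transition_function_def)
      define R where "R = (\<Sum>y\<in>{0..C}. P h x y * ?g s y) - ?g s x - h * generator N \<nu> \<mu> (?g s) x"
      \<comment> \<open>Rows of \<open>P\<close> sum to \<open>1\<close>, so everything can be
        written with differences \<open>?g s y - ?g s x\<close>. These vanish on the diagonal, and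
        only off-diagonal rates enter.\<close>
      have "R = (\<Sum>y\<in>{0..C}. P h x y * ?g s y) - (\<Sum>y\<in>{0..C}. P h x y) * ?g s x
          - h * (\<Sum>y\<in>{0..C}. ?q x y * (?g s y - ?g s x))"
        unfolding R_def rows generator_eq_engset_sum[OF x] by simp
      also have "\<dots> = (\<Sum>y\<in>{0..C}. (P h x y - h * ?q x y) * (?g s y - ?g s x))"
        by (simp add: sum_distrib_left sum_distrib_right sum_subtractf[symmetric] algebra_simps)
      finally have R_eq: "R = (\<Sum>y\<in>{0..C}. (P h x y - h * ?q x y) * (?g s y - ?g s x))" .
      have "\<bar>R\<bar> \<le> (\<Sum>y\<in>{0..C}. h * (if x = y then 0 else \<bar>P h x y / h - ?q x y\<bar>))"
        unfolding R_eq
      proof (rule order_trans[OF sum_abs sum_mono])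
        fix y assume "y \<in> {0..C}"
        have "\<bar>?g s y - ?g s x\<bar> \<le> 1"
          using tail_prob_bounds[OF par(1-3) s, of N C x] tail_prob_bounds[OF par(1-3) s, of N C y]
          by linarith
        moreover have "P h x y - h * ?q x y = h * (P h x y / h - ?q x y)"
          using h by (simp add: algebra_simps)
        ultimately show "\<bar>(P h x y - h * ?q x y) * (?g s y - ?g s x)\<bar>
            \<le> h * (if x = y then 0 else \<bar>P h x y / h - ?q x y\<bar>)"
          using h by (auto simp: abs_mult intro: mult_left_le)
      qed
      also have "\<dots> = h * (\<Sum>y\<in>{0..C}. if x = y then 0 else \<bar>P h x y / h - ?q x y\<bar>)"
        by (simp add: sum_distrib_left)
      also have "\<dots> \<le> h * (\<Sum>x\<in>{0..C}. \<Sum>y\<in>{0..C}. if x = y then 0 else \<bar>P h x y / h - ?q x y\<bar>)"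
        using h x by (intro mult_left_mono member_le_sum) (auto intro: sum_nonneg)
      finally have R: "\<bar>R\<bar> \<le> h * (e h - 4 * (real N)\<^sup>2 * h)" by (simp add: e_def)
      have "x < N" using x par by simp
      note T = tail_prob_taylor[OF par(1-3) this s h, of C]
      have "\<bar>?g (s + h) x - (\<Sum>y\<in>{0..C}. P h x y * ?g s y)\<bar> \<le>
         4 * (real N)\<^sup>2 * h\<^sup>2 + h * (e h - 4 * (real N)\<^sup>2 * h)"
        using T R unfolding R_def by linarith
      also have "\<dots> = e h * h" by (simp add: power2_eq_square algebra_simps)
      also have "\<dots> \<le> \<epsilon> * h" using elim h by simp
      finally show "\<bar>?g (s + h) x - (\<Sum>y\<in>{0..C}. P h x y * ?g s y)\<bar> \<le> \<epsilon> * h" .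
    qed
  qed
qed

text \<open>Below \<open>C\<close> both quantities obey the same one-step recursion up to
  \<open>\<epsilon> * h\<close>, so errors add up to \<open>k * (\<epsilon> * h)\<close>. At
  \<open>C\<close> the first bound is trivial, as the hitting probability is \<open>1\<close>; in
  the second, the delay \<open>d\<close> leaves at least time \<open>d\<close> after any hit, so
  that \<open>\<kappa>\<close> applies. This replaces an appeal to the strong Markov
  property.\<close>

lemma tail_prob_grid_hit_compare:
  assumes par: "0 < \<mu>" "0 < \<nu>" "\<mu> + \<nu> = 1" "0 \<le> \<epsilon>" "0 < h"
    and P: "transition_function {0..C} P"
    and err: "\<And>s x. 0 \<le> s \<Longrightarrow> x < C \<Longrightarrow>
      \<bar>tail_prob N C \<nu> \<mu> (s + h) x - (\<Sum>y\<in>{0..C}. P h x y * tail_prob N C \<nu> \<mu> s y)\<bar> \<le> \<epsilon> * h"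
    and "x \<le> C"
  shows tail_prob_le_grid_hit:
      "tail_prob N C \<nu> \<mu> (real k * h) x \<le> grid_hit {0..C} (P h) C k x + real k * (\<epsilon> * h)"
    and grid_hit_le_tail_prob:
      "\<lbrakk>0 \<le> d; \<And>s. d \<le> s \<Longrightarrow> \<kappa> \<le> tail_prob N C \<nu> \<mu> s C\<rbrakk> \<Longrightarrow>
        \<kappa> * grid_hit {0..C} (P h) C k x \<le> tail_prob N C \<nu> \<mu> (real k * h + d) x + real k * (\<epsilon> * h)"
proof -
  let ?g = "tail_prob N C \<nu> \<mu>" and ?v = "grid_hit {0..C} (P h) C"
  have rows: "(\<Sum>y\<in>{0..C}. P h x y) = 1" and pos: "\<And>y. y \<le> C \<Longrightarrow> 0 \<le> P h x y" if "x \<le> C" for x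
    using P that \<open>0 < h\<close> by (auto simp: transition_function_def)
  have avg: "(\<Sum>y\<in>{0..C}. P h x y * a y) \<le> (\<Sum>y\<in>{0..C}. P h x y * b y) + c"
    if "x \<le> C" "\<And>y. y \<le> C \<Longrightarrow> a y \<le> b y + c" for x a b c
  proof -
    have "(\<Sum>y\<in>{0..C}. P h x y * a y) \<le> (\<Sum>y\<in>{0..C}. P h x y * (b y + c))"
      using that pos by (intro sum_mono mult_left_mono) auto
    also have "\<dots> = (\<Sum>y\<in>{0..C}. P h x y * b y) + (\<Sum>y\<in>{0..C}. P h x y) * c"
      by (simp add: distrib_left sum.distrib sum_distrib_right)
    finally show ?thesis using rows[OF that(1)] by simp
  qed
  show "?g (real k * h) x \<le> ?v k x + real k * (\<epsilon> * h)"
    using \<open>x \<le> C\<close>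
  proof (induction k arbitrary: x)
    case 0
    then show ?case using par by (simp add: tail_prob_0)
  next
    case (Suc k)
    show ?case
    proof (cases "x = C")
      case True
      have "?g (real (Suc k) * h) x \<le> 1"
        using par by (intro tail_prob_bounds) auto
      moreover have "0 \<le> real (Suc k) * (\<epsilon> * h)" using par by simp
      ultimately show ?thesis using True by simp
    next
      case False
      then have x: "x < C" using Suc by simp
      have "?g (real k * h + h) x \<le> (\<Sum>y\<in>{0..C}. P h x y * ?g (real k * h) y) + \<epsilon> * h"
        using err[of "real k * h" x] x par by auto
      also have "\<dots> \<le> (\<Sum>y\<in>{0..C}. P h x y * ?v k y) + real k * (\<epsilon> * h) + \<epsilon> * h"
        using avg[of x "?g (real k * h)" "?v k"] Suc x by auto
      finally show ?thesis using False by (simp add: algebra_simps)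
    qed
  qed
  show "\<kappa> * ?v k x \<le> ?g (real k * h + d) x + real k * (\<epsilon> * h)"
    if d: "0 \<le> d" and \<kappa>: "\<And>s. d \<le> s \<Longrightarrow> \<kappa> \<le> ?g s C"
    using \<open>x \<le> C\<close>
  proof (induction k arbitrary: x)
    case 0
    then show ?case using par d \<kappa>[of d] tail_prob_bounds(1)[OF par(1-3) d] by simp
  next
    case (Suc k)
    have ge: "0 \<le> real (Suc k) * (\<epsilon> * h)" using par by simp
    show ?case
    proof (cases "x = C")
      case True
      then have "\<kappa> * ?v (Suc k) x = \<kappa>" by simp
      moreover have "\<kappa> \<le> ?g (real (Suc k) * h + d) C" using par by (intro \<kappa>) simp
      ultimately show ?thesis unfolding True using ge by linarith
    next
      case False
      then have x: "x < C" using Suc by simp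
      have "\<kappa> * ?v (Suc k) x = (\<Sum>y\<in>{0..C}. P h x y * (\<kappa> * ?v k y))"
        using False by (simp add: sum_distrib_left mult_ac)
      also have "\<dots> \<le> (\<Sum>y\<in>{0..C}. P h x y * ?g (real k * h + d) y) + real k * (\<epsilon> * h)"
        using Suc x by (intro avg) auto
      also have "(\<Sum>y\<in>{0..C}. P h x y * ?g (real k * h + d) y) \<le> ?g (real k * h + d + h) x + \<epsilon> * h"
        using err[of "real k * h + d" x] x par d by auto
      finally show ?thesis by (simp add: algebra_simps)
    qed
  qed
qed

section \<open>Observing a finite Markov jump process along a time grid\<close>

context finite_markov_jump_process
begin

lemma X_in_states: "0 \<le> t \<Longrightarrow> \<omega> \<in> space M \<Longrightarrow> X t \<omega> \<in> S"
  using measurable_X[of t] by (auto dest: measurable_space)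

lemma event_X: "0 \<le> t \<Longrightarrow> {\<omega> \<in> space M. Q (X t \<omega>)} \<in> events"
proof -
  assume t: "0 \<le> t"
  have "{\<omega> \<in> space M. Q (X t \<omega>)} = X t -` {x \<in> S. Q x} \<inter> space M"
    using X_in_states[OF t] by auto
  then show ?thesis using measurable_sets[OF measurable_X[OF t], of "{x \<in> S. Q x}"] by simp
qed

lemma event_All: "(\<And>i. Q i \<Longrightarrow> {\<omega> \<in> space M. R i \<omega>} \<in> events) \<Longrightarrow> {\<omega> \<in> space M. \<forall>i::nat. Q i \<longrightarrow> R i \<omega>} \<in> events"
  using sets.sets_Collect_countable_All[of M "\<lambda>i \<omega>. Q i \<longrightarrow> R i \<omega>"] by (auto simp: sets.sets_Collect_const)

lemma event_Ex: "(\<And>i. Q i \<Longrightarrow> {\<omega> \<in> space M. R i \<omega>} \<in> events) \<Longrightarrow> {\<omega> \<in> space M. \<exists>i::nat. Q i \<and> R i \<omega>} \<in> events"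
  using sets.sets_Collect_countable_Ex[of M "\<lambda>i \<omega>. Q i \<and> R i \<omega>"] by (auto simp: sets.sets_Collect_const)

text \<open>The Markov property multiplied out, so that histories of probability \<open>0\<close>,
  excluded from the conditional form, are covered as well.\<close>

lemma markov_grid_path:
  assumes P: "markov_with_transition_function S M X P" and h: "0 < h"
    and w: "\<And>i. i \<le> n \<Longrightarrow> w i \<in> S" and y: "y \<in> S"
  shows "\<P>(\<omega> in M. X (real (Suc n) * h) \<omega> = y \<and> (\<forall>i\<le>n. X (real i * h) \<omega> = w i)) =
     \<P>(\<omega> in M. \<forall>i\<le>n. X (real i * h) \<omega> = w i) * P h (w n) y"
proof -
  let ?A = "{\<omega> \<in> space M. \<forall>i\<le>n. X (real i * h) \<omega> = w i}"
  let ?B = "{\<omega> \<in> space M. X (real (Suc n) * h) \<omega> = y \<and> (\<forall>i\<le>n. X (real i * h) \<omega> = w i)}"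
  have meas: "?A \<in> events"
    using h by (intro event_All event_X) auto
  show ?thesis
  proof (cases "prob ?A = 0")
    case True
    have "prob ?B \<le> prob ?A" by (rule finite_measure_mono[OF _ meas]) blast
    then have "prob ?B = 0" using True measure_nonneg[of M ?B] by linarith
    then show ?thesis using True by (simp only: mult_zero_left)
  next
    case False
    then have "0 < prob ?A" by (simp add: zero_less_measure_iff)
    then have "\<P>(\<omega> in M. X (real n * h + h) \<omega> = y \<bar> \<forall>i\<le>n. X (real i * h) \<omega> = w i) = P h (w n) y"
      using P[unfolded markov_with_transition_function_def, rule_format, of h y "\<lambda>i. real i * h" n w] h w y
      by simp
    then have "prob {\<omega> \<in> space M. X (real n * h + h) \<omega> = y \<and> (\<forall>i\<le>n. X (real i * h) \<omega> = w i)} =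
        prob ?A * P h (w n) y"
      unfolding cond_prob_def nonzero_divide_eq_eq[OF False] by (simp only: mult.commute)
    moreover have "real n * h + h = real (Suc n) * h" by (simp add: algebra_simps)
    ultimately show ?thesis by (simp only:)
  qed
qed

text \<open>A taboo probability. The last time \<open>n\<close> is exempt from the taboo, so that
  \<open>avoid_prob h c n c\<close> is the probability of a first grid visit to \<open>c\<close> at
  step \<open>n\<close>.\<close>

definition avoid_prob :: "real \<Rightarrow> nat \<Rightarrow> nat \<Rightarrow> nat \<Rightarrow> real" where
  "avoid_prob h c n x = \<P>(\<omega> in M. (\<forall>j<n. X (real j * h) \<omega> \<noteq> c) \<and> X (real n * h) \<omega> = x)"

lemma avoid_event: "0 < h \<Longrightarrow> {\<omega> \<in> space M. (\<forall>j<n. X (real j * h) \<omega> \<noteq> c) \<and> X (real n * h) \<omega> = x} \<in> events"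
  by (intro sets.sets_Collect_conj event_All event_X) auto

text \<open>The taboo event is a finite disjoint union of grid paths.
  \<open>markov_grid_path\<close> applies to each, and the transition factor depends only on the
  common endpoint \<open>x\<close>.\<close>

lemma markov_grid_avoid:
  assumes P: "markov_with_transition_function S M X P" and h: "0 < h" and "x \<in> S" "y \<in> S"
  shows "\<P>(\<omega> in M. X (real (Suc n) * h) \<omega> = y \<and> (\<forall>j<n. X (real j * h) \<omega> \<noteq> c) \<and> X (real n * h) \<omega> = x)
     = avoid_prob h c n x * P h x y"
proof -
  define W where "W = {w \<in> PiE {..n} (\<lambda>_. S). (\<forall>j<n. w j \<noteq> c) \<and> w n = x}"
  have fin: "finite W" unfolding W_def using finite_states by (simp add: finite_PiE)
  \<comment> \<open>Used twice: with \<open>Q\<close> the event for the next state, and with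
    \<open>Q\<close> true to reassemble \<open>avoid_prob\<close>.\<close>
  have split: "\<P>(\<omega> in M. Q \<omega> \<and> (\<forall>j<n. X (real j * h) \<omega> \<noteq> c) \<and> X (real n * h) \<omega> = x)
     = (\<Sum>w\<in>W. \<P>(\<omega> in M. Q \<omega> \<and> (\<forall>i\<le>n. X (real i * h) \<omega> = w i)))"
    if Q: "{\<omega> \<in> space M. Q \<omega>} \<in> events" for Q
  proof -
    have "{\<omega> \<in> space M. Q \<omega> \<and> (\<forall>j<n. X (real j * h) \<omega> \<noteq> c) \<and> X (real n * h) \<omega> = x} =
       (\<Union>w\<in>W. {\<omega> \<in> space M. Q \<omega> \<and> (\<forall>i\<le>n. X (real i * h) \<omega> = w i)})"
    proof (intro equalityI subsetI)
      fix \<omega> assume \<omega>: "\<omega> \<in> {\<omega> \<in> space M. Q \<omega> \<and> (\<forall>j<n. X (real j * h) \<omega> \<noteq> c) \<and> X (real n * h) \<omega> = x}"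
      then have "restrict (\<lambda>i. X (real i * h) \<omega>) {..n} \<in> W"
        unfolding W_def using X_in_states h by auto
      then show "\<omega> \<in> (\<Union>w\<in>W. {\<omega> \<in> space M. Q \<omega> \<and> (\<forall>i\<le>n. X (real i * h) \<omega> = w i)})"
        using \<omega> by (intro UN_I[of "restrict (\<lambda>i. X (real i * h) \<omega>) {..n}"]) auto
    qed (auto simp: W_def)
    moreover have "disjoint_family_on (\<lambda>w. {\<omega> \<in> space M. Q \<omega> \<and> (\<forall>i\<le>n. X (real i * h) \<omega> = w i)}) W"
      unfolding disjoint_family_on_def
    proof (intro ballI impI)
      fix v w assume vw: "v \<in> W" "w \<in> W" "v \<noteq> w"
      have "\<exists>i\<in>{..n}. v i \<noteq> w i"
      proof (rule ccontr)
        assume "\<not> ?thesis"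
        then have "v = w" using vw(1,2) unfolding W_def by (intro PiE_ext[of v "{..n}" "\<lambda>_. S" w]) auto
        with vw(3) show False by simp
      qed
      then obtain i where "i \<in> {..n}" "v i \<noteq> w i" by blast
      then show "{\<omega> \<in> space M. Q \<omega> \<and> (\<forall>i\<le>n. X (real i * h) \<omega> = v i)} \<inter>
        {\<omega> \<in> space M. Q \<omega> \<and> (\<forall>i\<le>n. X (real i * h) \<omega> = w i)} = {}" by force
    qed
    moreover have "{\<omega> \<in> space M. Q \<omega> \<and> (\<forall>i\<le>n. X (real i * h) \<omega> = w i)} \<in> events" for w
      using h by (intro sets.sets_Collect_conj event_All event_X Q) auto
    ultimately show ?thesis
      using fin by (simp add: finite_measure_finite_Union image_subset_iff)
  qed
  have ev: "{\<omega> \<in> space M. X (real (Suc n) * h) \<omega> = y} \<in> events"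
    using h by (intro event_X) simp
  have "\<P>(\<omega> in M. X (real (Suc n) * h) \<omega> = y \<and> (\<forall>j<n. X (real j * h) \<omega> \<noteq> c) \<and> X (real n * h) \<omega> = x)
     = (\<Sum>w\<in>W. \<P>(\<omega> in M. \<forall>i\<le>n. X (real i * h) \<omega> = w i) * P h (w n) y)"
    unfolding split[OF ev]
    by (rule sum.cong[OF refl], rule markov_grid_path[OF P h _ \<open>y \<in> S\<close>]) (auto simp: W_def)
  also have "\<dots> = (\<Sum>w\<in>W. \<P>(\<omega> in M. \<forall>i\<le>n. X (real i * h) \<omega> = w i)) * P h x y"
    unfolding sum_distrib_right by (rule sum.cong) (auto simp: W_def)
  also have "(\<Sum>w\<in>W. \<P>(\<omega> in M. \<forall>i\<le>n. X (real i * h) \<omega> = w i)) = avoid_prob h c n x"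
    using split[of "\<lambda>_. True"] by (simp add: avoid_prob_def)
  finally show ?thesis .
qed

lemma avoid_prob_Suc:
  assumes P: "markov_with_transition_function S M X P" and h: "0 < h" and "y \<in> S"
  shows "avoid_prob h c (Suc n) y = (\<Sum>x\<in>S - {c}. avoid_prob h c n x * P h x y)"
proof -
  let ?E = "\<lambda>x. {\<omega> \<in> space M. X (real (Suc n) * h) \<omega> = y \<and> (\<forall>j<n. X (real j * h) \<omega> \<noteq> c) \<and> X (real n * h) \<omega> = x}"
  have "{\<omega> \<in> space M. (\<forall>j<Suc n. X (real j * h) \<omega> \<noteq> c) \<and> X (real (Suc n) * h) \<omega> = y} = (\<Union>x\<in>S - {c}. ?E x)"
    using X_in_states[of "real n * h"] h by (auto simp: less_Suc_eq)
  moreover have "?E x \<in> events" for x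
    using h by (intro sets.sets_Collect_conj event_All event_X) auto
  moreover have "disjoint_family_on ?E (S - {c})" by (auto simp: disjoint_family_on_def)
  ultimately have "avoid_prob h c (Suc n) y = (\<Sum>x\<in>S - {c}. prob (?E x))"
    unfolding avoid_prob_def using finite_states finite_measure_finite_Union[of "S - {c}" ?E]
    by (simp add: image_subset_iff)
  also have "\<dots> = (\<Sum>x\<in>S - {c}. avoid_prob h c n x * P h x y)"
    by (rule sum.cong[OF refl], rule markov_grid_avoid[OF P h _ \<open>y \<in> S\<close>]) auto
  finally show ?thesis .
qed

lemma prob_grid_hit_Suc:
  assumes h: "0 < h"
  shows "\<P>(\<omega> in M. \<exists>j<Suc n. X (real j * h) \<omega> = c) =
    \<P>(\<omega> in M. \<exists>j<n. X (real j * h) \<omega> = c) + avoid_prob h c n c"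
proof -
  have m: "{\<omega> \<in> space M. \<exists>j<n. X (real j * h) \<omega> = c} \<in> events"
    using h by (intro event_Ex event_X) auto
  have eq: "{\<omega> \<in> space M. \<exists>j<Suc n. X (real j * h) \<omega> = c} = {\<omega> \<in> space M. \<exists>j<n. X (real j * h) \<omega> = c} \<union>
      {\<omega> \<in> space M. (\<forall>j<n. X (real j * h) \<omega> \<noteq> c) \<and> X (real n * h) \<omega> = c}"
    by (auto simp: less_Suc_eq)
  show ?thesis
    unfolding eq avoid_prob_def
    by (rule finite_measure_Union[OF m avoid_event[OF h]]) blast
qed

lemma prob_grid_hit:
  assumes P: "markov_with_transition_function S M X P" and h: "0 < h"
    and c: "c \<in> S" and x: "x \<in> S" "AE \<omega> in M. X 0 \<omega> = x"
  shows "\<P>(\<omega> in M. \<exists>j\<le>n. X (real j * h) \<omega> = c) = grid_hit S (P h) c n x"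
proof -
  let ?v = "grid_hit S (P h) c"
  \<comment> \<open>\<open>\<Phi> m k\<close> follows the process for \<open>m\<close> steps and
    leaves the next \<open>k\<close> to \<open>grid_hit\<close>. The forward recursion of
    \<open>avoid_prob\<close> and the backward recursion of \<open>grid_hit\<close> make it depend
    on \<open>m + k\<close> only; the claim is \<open>\<Phi> 0 n = \<Phi> n 0\<close>.\<close>
  define \<Phi> where "\<Phi> m k = \<P>(\<omega> in M. \<exists>j<m. X (real j * h) \<omega> = c) + (\<Sum>z\<in>S. avoid_prob h c m z * ?v k z)" for m k
  have step: "\<Phi> m (Suc k) = \<Phi> (Suc m) k" for m k
  proof -
    have "(\<Sum>y\<in>S. avoid_prob h c (Suc m) y * ?v k y) =
       (\<Sum>y\<in>S. \<Sum>z\<in>S - {c}. avoid_prob h c m z * P h z y * ?v k y)"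
      by (simp add: avoid_prob_Suc[OF P h] sum_distrib_right)
    also have "\<dots> = (\<Sum>z\<in>S - {c}. avoid_prob h c m z * (\<Sum>y\<in>S. P h z y * ?v k y))"
      by (subst sum.swap) (simp add: sum_distrib_left mult_ac)
    also have "\<dots> = (\<Sum>z\<in>S - {c}. avoid_prob h c m z * ?v (Suc k) z)"
      by (rule sum.cong) auto
    finally have "(\<Sum>y\<in>S. avoid_prob h c (Suc m) y * ?v k y) =
        (\<Sum>z\<in>S - {c}. avoid_prob h c m z * ?v (Suc k) z)" .
    moreover have "(\<Sum>z\<in>S. avoid_prob h c m z * ?v (Suc k) z) =
        avoid_prob h c m c + (\<Sum>z\<in>S - {c}. avoid_prob h c m z * ?v (Suc k) z)"
      using sum.remove[OF finite_states c, of "\<lambda>z. avoid_prob h c m z * ?v (Suc k) z"] by simp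
    ultimately show ?thesis
      unfolding \<Phi>_def prob_grid_hit_Suc[OF h] by linarith
  qed
  have "\<Phi> m k = \<Phi> (m + k) 0" for m k
  proof (induction k arbitrary: m)
    case (Suc k)
    show ?case unfolding step Suc by simp
  qed simp
  from this[of 0 n] have "\<Phi> 0 n = \<Phi> n 0" by simp
  moreover have "\<Phi> 0 n = ?v n x"
  proof -
    have "avoid_prob h c 0 z = (if z = x then 1 else 0)" for z
    proof (cases "z = x")
      case True
      then show ?thesis using x(2) event_X[of 0 "\<lambda>y. y = x"] by (simp add: avoid_prob_def prob_Collect_eq_1)
    next
      case False
      then have "AE \<omega> in M. X 0 \<omega> \<noteq> z" using x(2) by auto
      then show ?thesis using False event_X[of 0 "\<lambda>y. y = z"] by (simp add: avoid_prob_def prob_Collect_eq_0)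
    qed
    then have "(\<Sum>z\<in>S. avoid_prob h c 0 z * ?v n z) = (\<Sum>z\<in>S. if z = x then ?v n z else 0)"
      by (intro sum.cong) auto
    then show ?thesis using finite_states x(1) by (simp add: \<Phi>_def)
  qed
  moreover have "\<Phi> n 0 = \<P>(\<omega> in M. \<exists>j<Suc n. X (real j * h) \<omega> = c)"
  proof -
    have "(\<Sum>z\<in>S. avoid_prob h c n z * ?v 0 z) = (\<Sum>z\<in>S. if z = c then avoid_prob h c n c else 0)"
      by (rule sum.cong) auto
    then show ?thesis using finite_states c unfolding \<Phi>_def prob_grid_hit_Suc[OF h] by simp
  qed
  ultimately show ?thesis by (simp add: less_Suc_eq_le)
qed

end

section \<open>Hitting times in continuous time\<close>

lemma hitting_time_less_iff: "hitting_time X c \<omega> < a \<longleftrightarrow> (\<exists>s\<ge>0. X s \<omega> = c \<and> ereal s < a)"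
  by (auto simp: hitting_time_def INF_less_iff)

lemma hitting_time_nonneg: "0 \<le> hitting_time X c \<omega>"
  unfolding hitting_time_def by (rule INF_greatest) simp

lemma hitting_time_le: "0 \<le> s \<Longrightarrow> X s \<omega> = c \<Longrightarrow> hitting_time X c \<omega> \<le> ereal s"
  unfolding hitting_time_def by (rule INF_lower) simp

context finite_markov_jump_process
begin

lemma constant_right:
  assumes "\<omega> \<in> space M" "0 \<le> t"
  obtains r where "t < r" "\<And>s. t \<le> s \<Longrightarrow> s < r \<Longrightarrow> X s \<omega> = X t \<omega>"
proof -
  have "((\<lambda>s. X s \<omega>) \<longlongrightarrow> X t \<omega>) (at_right t)"
    using right_continuous[OF assms] by (simp add: continuous_within)
  then have "\<forall>\<^sub>F s in at_right t. X s \<omega> \<in> {X t \<omega>}"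
    by (rule topological_tendstoD) (rule discrete_topology_class.open_discrete, simp)
  then obtain r where "t < r" "\<And>s. t < s \<Longrightarrow> s < r \<Longrightarrow> X s \<omega> = X t \<omega>"
    unfolding eventually_at_right_field by auto
  then show thesis by (intro that[of r]) (auto simp: le_less)
qed

text \<open>By right-continuity every visit to \<open>c\<close> lasts for a nondegenerate interval
  and is seen at a rational time, so a countable union of events suffices.\<close>

lemma hitting_time_measurable: "hitting_time X c \<in> borel_measurable M"
proof (rule borel_measurableI_less)
  fix a :: ereal
  have "{\<omega> \<in> space M. hitting_time X c \<omega> < a} =
      (\<Union>q\<in>{q\<in>\<rat>. 0 \<le> q \<and> ereal q < a}. {\<omega> \<in> space M. X q \<omega> = c})"
  proof (intro equalityI subsetI)
    fix \<omega> assume "\<omega> \<in> {\<omega> \<in> space M. hitting_time X c \<omega> < a}"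
    then obtain s where s: "0 \<le> s" "X s \<omega> = c" "ereal s < a" and \<omega>: "\<omega> \<in> space M"
      by (auto simp: hitting_time_less_iff)
    obtain r where r: "s < r" "\<And>u. s \<le> u \<Longrightarrow> u < r \<Longrightarrow> X u \<omega> = X s \<omega>"
      using constant_right[OF \<omega> s(1)] by blast
    obtain b where b: "s < b" "ereal b < a"
      using ereal_dense2[OF s(3)] by auto
    obtain q where "q \<in> \<rat>" "s < q" "q < min r b"
      using Rats_dense_in_real[of s "min r b"] r(1) b(1) by auto
    then show "\<omega> \<in> (\<Union>q\<in>{q\<in>\<rat>. 0 \<le> q \<and> ereal q < a}. {\<omega> \<in> space M. X q \<omega> = c})"
      using s r(2)[of q] b \<omega> by (intro UN_I[of q]) (auto intro: less_trans[of "ereal q" "ereal b"])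
  qed (auto simp: hitting_time_less_iff)
  moreover have "countable {q\<in>\<rat>. 0 \<le> q \<and> ereal q < a}"
    using countable_rat by (rule countable_subset[rotated]) auto
  ultimately show "{\<omega> \<in> space M. hitting_time X c \<omega> < a} \<in> events"
    by (simp only:) (intro sets.countable_UN' image_subsetI; auto intro!: event_X)
qed

section \<open>Approximation of hitting events by dyadic grids\<close>

definition dyadic_hit :: "nat \<Rightarrow> real \<Rightarrow> nat \<Rightarrow> 'a set" where
  "dyadic_hit c t m = {\<omega> \<in> space M. \<exists>j\<le>2 ^ m. X (real j * (t / 2 ^ m)) \<omega> = c}"

lemma dyadic_hit_event: "0 < t \<Longrightarrow> dyadic_hit c t m \<in> events"
  unfolding dyadic_hit_def by (intro event_Ex event_X) simp

lemma dyadic_hit_subset: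
  assumes "0 < t"
  shows "dyadic_hit c t m \<subseteq> {\<omega> \<in> space M. hitting_time X c \<omega> \<le> ereal t}"
proof
  fix \<omega> assume "\<omega> \<in> dyadic_hit c t m"
  then obtain j where j: "\<omega> \<in> space M" "j \<le> 2 ^ m" "X (real j * (t / 2 ^ m)) \<omega> = c"
    by (auto simp: dyadic_hit_def)
  have "real j \<le> 2 ^ m" using j(2) by (metis of_nat_le_iff of_nat_numeral of_nat_power)
  then have "real j * (t / 2 ^ m) \<le> t" using assms by (simp add: field_simps)
  moreover have "hitting_time X c \<omega> \<le> ereal (real j * (t / 2 ^ m))"
    using assms j by (intro hitting_time_le) auto
  ultimately show "\<omega> \<in> {\<omega> \<in> space M. hitting_time X c \<omega> \<le> ereal t}"
    using j(1) by (auto intro: order_trans)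
qed

lemma incseq_dyadic_hit: "incseq (dyadic_hit c t)"
proof (rule incseq_SucI, rule subsetI)
  fix m \<omega> assume "\<omega> \<in> dyadic_hit c t m"
  then obtain j where j: "\<omega> \<in> space M" "j \<le> 2 ^ m" "X (real j * (t / 2 ^ m)) \<omega> = c"
    by (auto simp: dyadic_hit_def)
  have "real (2 * j) * (t / 2 ^ Suc m) = real j * (t / 2 ^ m)" by simp
  then show "\<omega> \<in> dyadic_hit c t (Suc m)"
    unfolding dyadic_hit_def using j by (auto intro!: exI[of _ "2 * j"])
qed

text \<open>A visit to \<open>c\<close> at \<open>s < t\<close> persists up to some
  \<open>b \<le> t\<close>, and a mesh smaller than \<open>b - s\<close> puts a grid point in
  between. The strict inequality provides the room before \<open>t\<close>.\<close>

lemma hitting_time_less_subset_dyadic_hit: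
  assumes "0 < t"
  shows "{\<omega> \<in> space M. hitting_time X c \<omega> < ereal t} \<subseteq> (\<Union>m. dyadic_hit c t m)"
proof
  fix \<omega> assume "\<omega> \<in> {\<omega> \<in> space M. hitting_time X c \<omega> < ereal t}"
  then obtain s where \<omega>: "\<omega> \<in> space M" and s: "0 \<le> s" "X s \<omega> = c" "s < t"
    by (auto simp: hitting_time_less_iff)
  obtain r where r: "s < r" "\<And>u. s \<le> u \<Longrightarrow> u < r \<Longrightarrow> X u \<omega> = X s \<omega>"
    using constant_right[OF \<omega> s(1)] by blast
  define b where "b = min r t"
  have b: "s < b" "b \<le> r" "b \<le> t" using r s by (auto simp: b_def)
  have "(\<lambda>m. t / 2 ^ m) \<longlonglongrightarrow> 0" by real_asymp
  then have "\<forall>\<^sub>F m in sequentially. t / 2 ^ m < b - s"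
    using b by (intro order_tendstoD(2)) auto
  then obtain m where m: "t / 2 ^ m < b - s" by (auto simp: eventually_sequentially)
  define h where "h = t / 2 ^ m"
  have h: "0 < h" using assms by (simp add: h_def)
  \<comment> \<open>The first grid point at or after \<open>s\<close>.\<close>
  define j where "j = nat \<lceil>s / h\<rceil>"
  have sj: "s / h \<le> real j" "real j < s / h + 1"
    using s h ceiling_correct[of "s / h"] by (auto simp: j_def)
  have lo: "s \<le> real j * h" using sj(1) h by (simp add: field_simps)
  have hi: "real j * h < b"
  proof -
    have "real j * h < (s / h + 1) * h" using sj(2) h by (rule mult_strict_right_mono)
    also have "\<dots> = s + h" using h by (simp add: field_simps)
    finally show ?thesis using m by (simp add: h_def)
  qed
  have "real j * h < 2 ^ m * h" using hi b by (simp add: h_def)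
  then have "real j < 2 ^ m" using h by simp
  then have "j \<le> 2 ^ m" by (metis less_imp_le of_nat_less_iff of_nat_numeral of_nat_power)
  moreover have "X (real j * h) \<omega> = c" using r(2)[OF lo] hi b s by auto
  ultimately show "\<omega> \<in> (\<Union>m. dyadic_hit c t m)"
    using \<omega> by (auto simp: dyadic_hit_def h_def)
qed

end

text \<open>Limit of the grid comparison as the mesh tends to \<open>0\<close>. The dyadic hitting
  events increase to an event between \<open>T < t\<close> and \<open>T \<le> t\<close>, with
  \<open>T\<close> the hitting time, which is why the two bounds use different inequalities.\<close>

lemma engset_hitting_time_bounds:
  assumes par: "0 < \<mu>" "0 < \<nu>" "\<mu> + \<nu> = 1" "C \<le> N"
    and X: "engset_process M N C \<nu> \<mu> X" "AE \<omega> in M. X 0 \<omega> = 0" and t: "0 < t"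
  shows tail_prob_le_hitting_prob:
      "tail_prob N C \<nu> \<mu> t 0 \<le> \<P>(\<omega> in M. hitting_time X C \<omega> \<le> ereal t)"
    and hitting_prob_le_tail_prob:
      "\<lbrakk>0 \<le> d; 0 \<le> \<kappa>; \<And>s. d \<le> s \<Longrightarrow> \<kappa> \<le> tail_prob N C \<nu> \<mu> s C\<rbrakk> \<Longrightarrow>
        \<kappa> * \<P>(\<omega> in M. hitting_time X C \<omega> < ereal t) \<le> tail_prob N C \<nu> \<mu> (t + d) 0"
proof -
  interpret finite_markov_jump_process M "{0..C}" "engset_rate N C \<nu> \<mu>" X
    using X(1) by (simp add: engset_process_def)
  let ?g = "tail_prob N C \<nu> \<mu>"
  obtain P where P: "transition_function {0..C} P" "has_transition_rates {0..C} P (engset_rate N C \<nu> \<mu>)"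
      "markov_with_transition_function {0..C} M X P"
    using markov by blast
  have hit: "prob (dyadic_hit C t m) = grid_hit {0..C} (P (t / 2 ^ m)) C (2 ^ m) 0" for m
    unfolding dyadic_hit_def using t X(2) by (intro prob_grid_hit P) auto
  have step: "filterlim (\<lambda>m. t / 2 ^ m) (at_right 0) sequentially"
    using t by real_asymp
  have err: "\<forall>\<^sub>F m in sequentially. \<forall>s\<ge>0. \<forall>x<C.
      \<bar>?g (s + t / 2 ^ m) x - (\<Sum>y\<in>{0..C}. P (t / 2 ^ m) x y * ?g s y)\<bar> \<le> \<epsilon> * (t / 2 ^ m)"
    if "0 < \<epsilon>" for \<epsilon>
    using tail_prob_one_step_error[OF par P(1,2) that] step by (rule eventually_compose_filterlim)
  \<comment> \<open>An error of \<open>\<epsilon> / t\<close> per unit of time adds up to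
    \<open>\<epsilon>\<close> over the \<open>2 ^ m\<close> steps.\<close>
  have mt: "real (2 ^ m) * (t / 2 ^ m) = t" "real (2 ^ m) * (\<epsilon> / t * (t / 2 ^ m)) = \<epsilon>" for m \<epsilon>
    using t by simp_all
  show "?g t 0 \<le> \<P>(\<omega> in M. hitting_time X C \<omega> \<le> ereal t)"
  proof (rule field_le_epsilon)
    fix \<epsilon> :: real assume \<epsilon>: "0 < \<epsilon>"
    obtain m where m: "\<forall>s\<ge>0. \<forall>x<C.
      \<bar>?g (s + t / 2 ^ m) x - (\<Sum>y\<in>{0..C}. P (t / 2 ^ m) x y * ?g s y)\<bar> \<le> \<epsilon> / t * (t / 2 ^ m)"
      using err[of "\<epsilon> / t"] \<epsilon> t by (auto simp: eventually_sequentially)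
    have "?g t 0 \<le> prob (dyadic_hit C t m) + \<epsilon>"
      using tail_prob_le_grid_hit[OF par(1-3) _ _ P(1) m[rule_format], of 0 "2 ^ m"] t \<epsilon>
      unfolding mt hit by simp
    also have "prob (dyadic_hit C t m) \<le> \<P>(\<omega> in M. hitting_time X C \<omega> \<le> ereal t)"
      using hitting_time_measurable
      by (intro finite_measure_mono dyadic_hit_subset[OF t]) measurable
    finally show "?g t 0 \<le> \<P>(\<omega> in M. hitting_time X C \<omega> \<le> ereal t) + \<epsilon>" by simp
  qed
  assume d: "0 \<le> d" and \<kappa>: "0 \<le> \<kappa>" "\<And>s. d \<le> s \<Longrightarrow> \<kappa> \<le> ?g s C"
  have dyadic: "(\<lambda>m. \<kappa> * prob (dyadic_hit C t m)) \<longlonglongrightarrow> \<kappa> * prob (\<Union>m. dyadic_hit C t m)"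
    using dyadic_hit_event[OF t]
    by (intro tendsto_mult_left finite_Lim_measure_incseq incseq_dyadic_hit) auto
  have "\<kappa> * prob (\<Union>m. dyadic_hit C t m) \<le> ?g (t + d) 0"
  proof (rule field_le_epsilon, rule tendsto_upperbound[OF dyadic])
    fix \<epsilon> :: real assume \<epsilon>: "0 < \<epsilon>"
    have "0 < \<epsilon> / t" using \<epsilon> t by simp
    from err[OF this] show "\<forall>\<^sub>F m in sequentially. \<kappa> * prob (dyadic_hit C t m) \<le> ?g (t + d) 0 + \<epsilon>"
    proof eventually_elim
      case (elim m)
      show ?case
        using grid_hit_le_tail_prob[OF par(1-3) _ _ P(1) elim[rule_format], of 0 d \<kappa> "2 ^ m"] t \<epsilon> d \<kappa>
        unfolding mt hit by simp
    qed
  qed simp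
  moreover have "\<P>(\<omega> in M. hitting_time X C \<omega> < ereal t) \<le> prob (\<Union>m. dyadic_hit C t m)"
    using dyadic_hit_event[OF t]
    by (intro finite_measure_mono hitting_time_less_subset_dyadic_hit t) auto
  ultimately show "\<kappa> * \<P>(\<omega> in M. hitting_time X C \<omega> < ereal t) \<le> ?g (t + d) 0"
    using \<kappa>(1) by (meson mult_left_mono order_trans)
qed

section \<open>Convergence in distribution\<close>

text \<open>This is the Chebyshev error of \<open>tail_prob_from_capacity\<close> at
  \<open>s = e / sqrt N\<close>. As \<open>\<nu> * N - C N\<close> grows like
  \<open>(\<nu> - \<eta>) * N\<close> and \<open>1 - exp (- s)\<close> decays like
  \<open>e / sqrt N\<close>, it is of order \<open>1 / sqrt N\<close>.\<close>

lemma return_prob_error_tendsto_0: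
  fixes C :: "nat \<Rightarrow> nat"
  assumes C: "(\<lambda>N. real (C N) - \<eta> * real N) \<in> O(\<lambda>_. 1)" and "\<eta> < \<nu>" and "0 < e"
  shows "(\<lambda>N. real N / ((1 - exp (- (e / sqrt N))) * (\<nu> * real N - real (C N))\<^sup>2)) \<longlonglongrightarrow> 0"
    and "\<forall>\<^sub>F N in sequentially. real (C N) < \<nu> * real N"
proof -
  have "(\<lambda>N. (real (C N) - \<eta> * real N) / real N) \<longlonglongrightarrow> 0"
  proof -
    have "(\<lambda>_. 1) \<in> o(\<lambda>N. real N)" by real_asymp
    with C have "(\<lambda>N. real (C N) - \<eta> * real N) \<in> o(\<lambda>N. real N)"
      by (rule landau_o.big_small_trans)
    then show ?thesis by (rule smalloD_tendsto)
  qed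
  then have "(\<lambda>N. \<nu> - \<eta> - (real (C N) - \<eta> * real N) / real N) \<longlonglongrightarrow> \<nu> - \<eta> - 0"
    by (intro tendsto_intros)
  moreover have ev: "\<forall>\<^sub>F N in sequentially. \<nu> - \<eta> - (real (C N) - \<eta> * real N) / real N
      = (\<nu> * real N - real (C N)) / real N"
    using eventually_gt_at_top[of 0] by eventually_elim (simp add: field_simps)
  ultimately have lim: "(\<lambda>N. (\<nu> * real N - real (C N)) / real N) \<longlonglongrightarrow> \<nu> - \<eta>"
    by (simp add: Lim_transform_eventually)
  have "\<forall>\<^sub>F N in sequentially. 0 < (\<nu> * real N - real (C N)) / real N"
    using lim assms(2) by (intro order_tendstoD(1)) auto
  then show "\<forall>\<^sub>F N in sequentially. real (C N) < \<nu> * real N"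
    by eventually_elim (auto simp: zero_less_divide_iff)
  have "(\<lambda>N. 1 / (real N * (1 - exp (- (e / sqrt (real N)))))) \<longlonglongrightarrow> 0"
    using \<open>0 < e\<close> by real_asymp
  then have "(\<lambda>N. 1 / (real N * (1 - exp (- (e / sqrt (real N))))) / ((\<nu> * real N - real (C N)) / real N)\<^sup>2)
      \<longlonglongrightarrow> 0 / (\<nu> - \<eta>)\<^sup>2"
    using assms(2) by (intro tendsto_intros lim) auto
  moreover have "\<forall>\<^sub>F N in sequentially.
      1 / (real N * (1 - exp (- (e / sqrt (real N))))) / ((\<nu> * real N - real (C N)) / real N)\<^sup>2 =
      real N / ((1 - exp (- (e / sqrt N))) * (\<nu> * real N - real (C N))\<^sup>2)"
    using eventually_gt_at_top[of 0]
    by eventually_elim (simp add: power2_eq_square)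
  ultimately show "(\<lambda>N. real N / ((1 - exp (- (e / sqrt N))) * (\<nu> * real N - real (C N))\<^sup>2)) \<longlonglongrightarrow> 0"
    by (simp add: Lim_transform_eventually)
qed

theorem proposition6:
  fixes \<mu> \<nu> \<eta> :: real
    and C :: "nat \<Rightarrow> nat"
    and M :: "nat \<Rightarrow> 'a measure"
    and X :: "nat \<Rightarrow> real \<Rightarrow> 'a \<Rightarrow> nat"
  assumes "0 < \<mu>" and "0 < \<nu>" and "\<mu> + \<nu> = 1"
    and "\<And>N. 1 \<le> N \<Longrightarrow> 1 \<le> C N \<and> C N \<le> N"
    and "\<And>N. 1 \<le> N \<Longrightarrow> engset_process (M N) N (C N) \<nu> \<mu> (X N)"
    and "\<And>N. 1 \<le> N \<Longrightarrow> AE \<omega> in M N. X N 0 \<omega> = 0"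
    and "0 < \<eta>" and "\<eta> \<le> 1" and "\<eta> < \<nu>"
    and "(\<lambda>N. real (C N) - \<eta> * real N) \<in> O(\<lambda>_. 1)"
  shows "converges_in_distribution M
           (\<lambda>N \<omega>. sqrt (real N) *
              (real_of_ereal (hitting_time (X N) (C N) \<omega>) - ln (\<nu> / (\<nu> - \<eta>))))
           (centered_normal (\<eta> * (1 - \<eta>) / (\<nu> - \<eta>)\<^sup>2))"
proof -
  note par = assms(1-3)
  define v where "v = \<eta> * (1 - \<eta>) / (\<nu> - \<eta>)\<^sup>2"
  \<comment> \<open>Here \<open>\<eta> < \<nu> = 1 - \<mu> < 1\<close>, so the limit law is
    nondegenerate.\<close>
  have v: "0 < v" using assms by (simp add: v_def)
  define F where "F = cdf (centered_normal v)"
  define time where "time N y = ln (\<nu> / (\<nu> - \<eta>)) + y / sqrt (real N)" for N :: nat and y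
  define T where "T N = hitting_time (X N) (C N)" for N
  define Y where "Y N \<omega> = sqrt (real N) * (real_of_ereal (T N \<omega>) - ln (\<nu> / (\<nu> - \<eta>)))" for N \<omega>
  define g where "g N y = tail_prob N (C N) \<nu> \<mu> (time N y) 0" for N y
  have clt: "(\<lambda>N. g N y) \<longlonglongrightarrow> F y" for y
    unfolding g_def time_def F_def v_def using assms by (intro tail_prob_clt) auto
  interpret G: real_distribution "centered_normal v" using centered_normal_props(1)[OF v] .
  have F_cont: "isCont F y" for y unfolding F_def by (rule centered_normal_props(3)[OF v])
  have time_pos: "\<forall>\<^sub>F N in sequentially. 0 < time N y" for y
  proof -
    have "0 < ln (\<nu> / (\<nu> - \<eta>))" using assms by simp
    moreover have "(\<lambda>N. time N y) \<longlonglongrightarrow> ln (\<nu> / (\<nu> - \<eta>))" unfolding time_def by real_asymp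
    ultimately show ?thesis by (intro order_tendstoD(1))
  qed
  have jump: "finite_markov_jump_process (M N) {0..C N} (engset_rate N (C N) \<nu> \<mu>) (X N)" if "0 < N" for N
    using assms(5)[of N] that by (simp add: engset_process_def)
  have T_meas: "T N \<in> borel_measurable (M N)" if "0 < N" for N
    unfolding T_def by (rule finite_markov_jump_process.hitting_time_measurable[OF jump[OF that]])
  \<comment> \<open>\<open>real_of_ereal\<close> sends infinity to \<open>0\<close>: for
    \<open>time N y \<ge> 0\<close> the event on the right also contains all paths that never reach
    \<open>C N\<close>. This is harmless for the lower bound and needs a separate estimate in the
    upper one.\<close>
  have cdf_eq: "cdf (distr (M N) borel (Y N)) y = \<P>(\<omega> in M N. real_of_ereal (T N \<omega>) \<le> time N y)"
    if "0 < N" for N y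
  proof -
    have "Y N \<in> borel_measurable (M N)" unfolding Y_def using T_meas[OF that] by measurable
    moreover have "Y N \<omega> \<le> y \<longleftrightarrow> real_of_ereal (T N \<omega>) \<le> time N y" for \<omega>
      using that by (simp add: Y_def time_def field_simps)
    ultimately show ?thesis
      by (simp add: cdf_def measure_distr vimage_def Int_def conj_commute)
  qed
  have lower: "g N y \<le> \<P>(\<omega> in M N. T N \<omega> \<le> ereal (time N y))"
    and upper: "\<lbrakk>0 \<le> d; 0 \<le> \<kappa>; \<And>s. d \<le> s \<Longrightarrow> \<kappa> \<le> tail_prob N (C N) \<nu> \<mu> s (C N)\<rbrakk> \<Longrightarrow>
        \<kappa> * \<P>(\<omega> in M N. T N \<omega> < ereal (time N y)) \<le> tail_prob N (C N) \<nu> \<mu> (time N y + d) 0"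
    if "0 < N" "0 < time N y" for N y d \<kappa>
    unfolding T_def g_def using that assms(4-6)[of N]
    by (auto intro!: tail_prob_le_hitting_prob hitting_prob_le_tail_prob par)
  have cdf_lower: "\<forall>\<^sub>F N in sequentially. g N y \<le> cdf (distr (M N) borel (Y N)) y" for y
    using time_pos[of y] eventually_gt_at_top[of 0]
  proof eventually_elim
    case (elim N)
    interpret finite_markov_jump_process "M N" "{0..C N}" "engset_rate N (C N) \<nu> \<mu>" "X N"
      by (rule jump) fact
    have "g N y \<le> \<P>(\<omega> in M N. T N \<omega> \<le> ereal (time N y))" using lower elim by blast
    also have "\<dots> \<le> \<P>(\<omega> in M N. real_of_ereal (T N \<omega>) \<le> time N y)"
    proof (rule finite_measure_mono)
      show "{\<omega> \<in> space (M N). real_of_ereal (T N \<omega>) \<le> time N y} \<in> events"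
        using T_meas[OF elim(2)] by measurable
      have "real_of_ereal (T N \<omega>) \<le> time N y" if "T N \<omega> \<le> ereal (time N y)" for \<omega>
        using that hitting_time_nonneg[of "X N" "C N" \<omega>]
        by (cases "T N \<omega>") (auto simp: T_def[symmetric])
      then show "{\<omega> \<in> space (M N). T N \<omega> \<le> ereal (time N y)} \<subseteq>
          {\<omega> \<in> space (M N). real_of_ereal (T N \<omega>) \<le> time N y}" by auto
    qed
    finally show ?case using cdf_eq elim by simp
  qed
  have cdf_upper: "\<forall>\<^sub>F N in sequentially. cdf (distr (M N) borel (Y N)) y < a"
    if a: "F y < a" for y a
  proof -
    have "(F \<longlongrightarrow> F y) (at_right y)"
      using F_cont[of y] by (simp add: continuous_at_imp_continuous_at_within continuous_within[symmetric])
    then have "\<forall>\<^sub>F u in at_right y. F u < (F y + a) / 2"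
      using a by (intro order_tendstoD(2)) auto
    then obtain u where u: "y < u" "F u < (F y + a) / 2"
      using eventually_happens[OF eventually_conj[OF _ eventually_at_right_less[of y]]] by fastforce
    \<comment> \<open>Half of the gap passes from \<open>\<le>\<close> to \<open><\<close>; the
      other half is the delay granted after the hit.\<close>
    define e where "e = (u - y) / 2"
    have e: "0 < e" "y + e + e = u" using u by (simp_all add: e_def field_simps)
    have "(F \<longlongrightarrow> 1) at_top"
      unfolding F_def by (rule G.cdf_lim_at_top_prob)
    \<comment> \<open>The level \<open>z\<close> bounds the probability of hitting after
      \<open>time N z\<close>, including never, by about \<open>(a - F y) / 2\<close>.\<close>
    then have "\<forall>\<^sub>F z in at_top. 1 - (a - F y) / 2 < F z"
      using a by (intro order_tendstoD(1)) auto
    then obtain z where z: "1 - (a - F y) / 2 < F z"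
      by (auto simp: eventually_at_top_linorder)
    define \<kappa> where "\<kappa> N = 1 - real N / ((1 - exp (- (e / sqrt N))) * (\<nu> * real N - real (C N))\<^sup>2)" for N :: nat
    note kr = return_prob_error_tendsto_0[OF assms(10,9) e(1)]
    have \<kappa>: "\<kappa> \<longlonglongrightarrow> 1 - 0"
      unfolding \<kappa>_def by (intro tendsto_intros kr(1))
    have \<kappa>_pos: "\<forall>\<^sub>F N in sequentially. 0 < \<kappa> N"
      using \<kappa> by (intro order_tendstoD(1)) auto
    have "(\<lambda>N. g N u / \<kappa> N + (1 - g N z)) \<longlonglongrightarrow> F u / (1 - 0) + (1 - F z)"
      by (intro tendsto_intros clt \<kappa>) simp
    \<comment> \<open>The limit is below \<open>(F y + a) / 2 + (a - F y) / 2 = a\<close>.\<close>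
    then have "\<forall>\<^sub>F N in sequentially. g N u / \<kappa> N + (1 - g N z) < a"
      using u z by (intro order_tendstoD(2)) (auto simp: field_simps)
    then show ?thesis
      using kr(2) \<kappa>_pos time_pos[of "y + e"] time_pos[of z] eventually_gt_at_top[of 0]
    proof eventually_elim
      case (elim N)
      interpret finite_markov_jump_process "M N" "{0..C N}" "engset_rate N (C N) \<nu> \<mu>" "X N"
        by (rule jump) fact
      have N: "0 < N" "C N \<le> N" using elim assms(4)[of N] by auto
      note [measurable] = T_meas[OF N(1)]
      have e': "0 < e / sqrt N" using e N by simp
      have "\<kappa> N \<le> tail_prob N (C N) \<nu> \<mu> s (C N)" if s: "e / sqrt N \<le> s" for s
      proof -
        \<comment> \<open>The Chebyshev error decreases in \<open>s\<close>, so its value at the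
          delay \<open>e / sqrt N\<close> serves all later times.\<close>
        have "real N / ((1 - exp (- s)) * (\<nu> * real N - real (C N))\<^sup>2)
            \<le> real N / ((1 - exp (- (e / sqrt N))) * (\<nu> * real N - real (C N))\<^sup>2)"
          using s e' elim N by (intro divide_left_mono mult_right_mono mult_pos_pos) auto
        then show ?thesis
          using tail_prob_from_capacity[OF par, of s "C N" N] s e' N elim by (simp add: \<kappa>_def)
      qed
      then have "\<kappa> N * \<P>(\<omega> in M N. T N \<omega> < ereal (time N (y + e)))
          \<le> tail_prob N (C N) \<nu> \<mu> (time N (y + e) + e / sqrt N) 0"
        using elim e' N by (intro upper) auto
      also have "time N (y + e) + e / sqrt N = time N u"
        unfolding e(2)[symmetric] by (simp add: time_def add_divide_distrib)
      finally have early: "\<P>(\<omega> in M N. T N \<omega> < ereal (time N (y + e))) \<le> g N u / \<kappa> N"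
        using elim by (simp add: g_def field_simps)
      have "{\<omega> \<in> space (M N). real_of_ereal (T N \<omega>) \<le> time N y} \<subseteq>
          {\<omega> \<in> space (M N). T N \<omega> < ereal (time N (y + e))} \<union>
          (space (M N) - {\<omega> \<in> space (M N). T N \<omega> \<le> ereal (time N z)})"
      proof
        fix \<omega> assume \<omega>: "\<omega> \<in> {\<omega> \<in> space (M N). real_of_ereal (T N \<omega>) \<le> time N y}"
        have "time N y < time N (y + e)" using e N by (simp add: time_def divide_strict_right_mono)
        with \<omega> show "\<omega> \<in> {\<omega> \<in> space (M N). T N \<omega> < ereal (time N (y + e))} \<union>
          (space (M N) - {\<omega> \<in> space (M N). T N \<omega> \<le> ereal (time N z)})"
          using hitting_time_nonneg[of "X N" "C N" \<omega>]
          by (cases "T N \<omega>") (auto simp: T_def[symmetric])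
      qed
      then have "\<P>(\<omega> in M N. real_of_ereal (T N \<omega>) \<le> time N y) \<le>
          prob ({\<omega> \<in> space (M N). T N \<omega> < ereal (time N (y + e))} \<union>
          (space (M N) - {\<omega> \<in> space (M N). T N \<omega> \<le> ereal (time N z)}))"
        by (intro finite_measure_mono) measurable
      also have "\<dots> \<le> \<P>(\<omega> in M N. T N \<omega> < ereal (time N (y + e))) +
          prob (space (M N) - {\<omega> \<in> space (M N). T N \<omega> \<le> ereal (time N z)})"
        by (intro measure_Un_le) measurable
      also have "prob (space (M N) - {\<omega> \<in> space (M N). T N \<omega> \<le> ereal (time N z)}) =
          1 - \<P>(\<omega> in M N. T N \<omega> \<le> ereal (time N z))"
        by (intro prob_compl) measurable
      also have "\<P>(\<omega> in M N. T N \<omega> < ereal (time N (y + e))) + \<dots> \<le> g N u / \<kappa> N + (1 - g N z)"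
        using early lower[of N z] elim by (intro add_mono) auto
      also have "\<dots> < a" using elim by simp
      finally show ?case using cdf_eq N by simp
    qed
  qed
  have "(\<lambda>N. cdf (distr (M N) borel (Y N)) y) \<longlonglongrightarrow> F y" for y
  proof (rule order_tendstoI)
    fix a assume "a < F y"
    from order_tendstoD(1)[OF clt this] cdf_lower[of y]
    show "\<forall>\<^sub>F N in sequentially. a < cdf (distr (M N) borel (Y N)) y"
      by eventually_elim simp
  qed (rule cdf_upper)
  then show ?thesis
    unfolding converges_in_distribution_def weak_conv_m_def weak_conv_def
    by (simp add: F_def v_def Y_def[abs_def] T_def)
qed

end
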